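(* Let $q\ge2$, let $\gamma>1$ be a constant, and let $1\le r\le n$. If $(\mathcal{S},f)$ is a $(k,\gamma)$-sketching family for the $2\to q$ norm of rank-$r$ real matrices with $n$ rows, then $k=\Omega(nr/d^2)$, where $d=\max\{n^{1/q},\sqrt{r}\}$.
   Context: $\|A\|_{2\to q}=\sup_{x\ne0}\frac{\|Ax\|_q}{\|x\|_2}$. A $(k,\alpha)$-sketching family for the $2\to q$ norm of a class of matrices is a pair $(\mathcal{S},f)$ where $\mathcal{S}$ is a distribution over linear maps $L$ from the matrix space to $\mathbb{R}^k$ and $f:\mathbb{R}^k\to\mathbb{R}$, such that for every $A$ in the class, $\Pr_{L\sim\mathcal{S}}\big[f(L(A))\in(\tfrac1\alpha\|A\|_{2\to q},\,\alpha\|A\|_{2\to q})\big]\ge \frac56$. *)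

theory Defs
  imports "HOL-Probability.Probability" "Jordan_Normal_Form.DL_Rank"
begin

unbundle no vec_syntax

text \<open>Dimensions vary inside the statements, so matrices and vectors are the carrier-based
  ones of Jordan_Normal_Form, where \<open>$\<close> is \<^const>\<open>vec_index\<close>.\<close>

definition lp_norm :: "real \<Rightarrow> real vec \<Rightarrow> real" where
  "lp_norm p v = (\<Sum>i<dim_vec v. \<bar>v $ i\<bar> powr p) powr (1 / p)"

definition two_to_norm :: "real \<Rightarrow> real mat \<Rightarrow> real" where
  "two_to_norm q A =
     (SUP x \<in> {x \<in> carrier_vec (dim_col A). x \<noteq> 0\<^sub>v (dim_col A)}.
        lp_norm q (A *\<^sub>v x) / lp_norm 2 x)"

text \<open>Matrices of rank exactly \<open>r\<close>. (With \<open>\<le> r\<close> the class would contain the zero matrix,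
  for which the open interval in the definition of a sketching family is empty.)\<close>

definition rank_class :: "nat \<Rightarrow> nat \<Rightarrow> nat \<Rightarrow> real mat set" where
  "rank_class n m r = {A \<in> carrier_mat n m. vec_space.rank n A = r}"

text \<open>\<open>\<real>\<^sup>k\<close> with its Borel sets, as the product space of \<open>k\<close> copies of \<open>\<real>\<close>.\<close>

abbreviation euclid_borel :: "nat \<Rightarrow> (nat \<Rightarrow> real) measure" where
  "euclid_borel k \<equiv> (\<Pi>\<^sub>M i\<in>{..<k}. borel)"

text \<open>Values of \<open>L\<close> outside \<open>carrier_mat n m\<close> are irrelevant.\<close>

definition mat_linear_map :: "nat \<Rightarrow> nat \<Rightarrow> nat \<Rightarrow> (real mat \<Rightarrow> nat \<Rightarrow> real) \<Rightarrow> bool" where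
  "mat_linear_map n m k L \<longleftrightarrow>
     (\<forall>A \<in> carrier_mat n m. L A \<in> space (euclid_borel k)) \<and>
     (\<forall>A \<in> carrier_mat n m. \<forall>B \<in> carrier_mat n m. \<forall>i<k. L (A + B) i = L A i + L B i) \<and>
     (\<forall>A \<in> carrier_mat n m. \<forall>a. \<forall>i<k. L (a \<cdot>\<^sub>m A) i = a * L A i)"

text \<open>A distribution over linear maps is a probability measure on a set of linear maps whose
  evaluations \<open>L \<mapsto> L A\<close> are random vectors; this includes every Borel probability measure on
  the finite-dimensional space of all linear maps. The recovery function is Borel, so that
  the events whose probability is taken are measurable.\<close>

definition sketching_family ::
  "nat \<Rightarrow> nat \<Rightarrow> real \<Rightarrow> real mat set \<Rightarrow> nat \<Rightarrow> real \<Rightarrow>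
   (real mat \<Rightarrow> nat \<Rightarrow> real) measure \<Rightarrow> ((nat \<Rightarrow> real) \<Rightarrow> real) \<Rightarrow> bool" where
  "sketching_family n m q C k \<alpha> S f \<longleftrightarrow>
     prob_space S \<and>
     (\<forall>L \<in> space S. mat_linear_map n m k L) \<and>
     (\<forall>A \<in> carrier_mat n m. (\<lambda>L. L A) \<in> S \<rightarrow>\<^sub>M euclid_borel k) \<and>
     f \<in> borel_measurable (euclid_borel k) \<and>
     (\<forall>A \<in> C. measure S {L \<in> space S.
         f (L A) \<in> {1 / \<alpha> * two_to_norm q A <..< \<alpha> * two_to_norm q A}} \<ge> 5 / 6)"

end

theory Submission
  imports Defs "Jordan_Normal_Form.DL_Rank_Submatrix" "Jordan_Normal_Form.Char_Poly"
begin

text \<open>Let \<open>X\<close> be an \<open>n \<times> r\<close> matrix with independent standard normal entries, padded by zero columns.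
  With probability at least 9/10 its \<open>2 \<rightarrow> q\<close> norm is at most \<open>T = K d\<close>, while adding
  \<open>t = (1 + \<gamma>\<^sup>2) T\<close> to one entry raises the norm to at least \<open>\<gamma>\<^sup>2 T\<close>; hence the sketch must
  distinguish \<open>X\<close> from \<open>X + t E\<^sub>p\<close> for every position \<open>p\<close>. A fixed linear map to \<open>\<real>\<^sup>k\<close> sees the
  perturbation \<open>t E\<^sub>p\<close> only through its projection \<open>t w\<^sub>p\<close> to a \<open>k\<close>-dimensional space, and
  \<open>\<Sum>\<^sub>p \<parallel>w\<^sub>p\<parallel>\<^sup>2 \<le> k\<close>. Averaged over the \<open>n r\<close> positions, the Gaussian shifts by \<open>t w\<^sub>p\<close>
  are therefore indistinguishable unless \<open>t\<^sup>2 k\<close> is of order \<open>n r\<close>.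

  For the norm bound, convexity lets one round a vector of norm at most \<open>\<surd>r\<close> to an integer vector
  of norm at most \<open>2\<surd>r\<close>, of which there are at most \<open>48\<^sup>r\<close>; for each of them an exponential
  moment bound gives a failure probability of at most \<open>exp (-10 d\<^sup>2)\<close>.\<close>

section \<open>Shifts of the standard Gaussian measure\<close>

definition gauss :: "real measure" where
  "gauss = density lborel std_normal_density"

definition gauss_PiM :: "'i set \<Rightarrow> ('i \<Rightarrow> real) measure" where
  "gauss_PiM I = (\<Pi>\<^sub>M i\<in>I. gauss)"

lemma space_gauss [simp]: "space gauss = UNIV"
  and sets_gauss [simp, measurable_cong]: "sets gauss = sets borel"
  by (simp_all add: gauss_def)

lemma prob_space_gauss: "prob_space gauss"
  unfolding gauss_def by (rule prob_space_normal_density) simp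

lemma sets_gauss_PiM [simp, measurable_cong]:
  "sets (gauss_PiM I) = sets (\<Pi>\<^sub>M i\<in>I. borel)"
  unfolding gauss_PiM_def by (intro sets_PiM_cong) auto

lemma space_gauss_PiM [simp]: "space (gauss_PiM I) = extensional I"
  by (simp add: gauss_PiM_def space_PiM PiE_UNIV_domain PiE_def)

interpretation gauss: prob_space gauss
  by (rule prob_space_gauss)

interpretation gauss_product: product_sigma_finite "\<lambda>_. gauss"
  by (simp add: product_sigma_finite_def gauss.sigma_finite_measure_axioms)

lemma prob_space_gauss_PiM: "prob_space (gauss_PiM I)"
  unfolding gauss_PiM_def by (rule prob_space_PiM) (rule prob_space_gauss)

text \<open>Completing the square turns \<open>std_normal_density (x - w)\<close> into
  \<open>std_normal_density x\<close> times an exponential factor; this is the Cameron-Martin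
  formula in dimension one.\<close>

lemma nn_integral_gauss_shift:
  assumes [measurable]: "h \<in> borel_measurable borel"
  shows "(\<integral>\<^sup>+x. h (x + w) \<partial>gauss) = (\<integral>\<^sup>+x. ennreal (exp (w * x - w\<^sup>2 / 2)) * h x \<partial>gauss)"
proof -
  have eq: "std_normal_density (x - w) = std_normal_density x * exp (w * x - w\<^sup>2 / 2)" for x
    by (simp add: std_normal_density_def exp_add[symmetric] power2_eq_square field_simps)
  have "(\<integral>\<^sup>+x. h (x + w) \<partial>gauss) = (\<integral>\<^sup>+x. ennreal (std_normal_density x) * h (x + w) \<partial>lborel)"
    unfolding gauss_def by (subst nn_integral_density) auto
  also have "\<dots> = (\<integral>\<^sup>+x. ennreal (std_normal_density (x - w)) * h x \<partial>lborel)"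
    by (subst (2) nn_integral_real_affine[where c=1 and t=w]) (auto simp: add.commute)
  also have "\<dots> = (\<integral>\<^sup>+x. ennreal (exp (w * x - w\<^sup>2 / 2)) * h x \<partial>gauss)"
    unfolding gauss_def
    by (subst nn_integral_density) (auto simp: eq ennreal_mult mult.assoc)
  finally show ?thesis .
qed

text \<open>The restriction to \<open>I\<close> makes the result extensional, hence again a point of
  the product space.\<close>

definition shift :: "'i set \<Rightarrow> ('i \<Rightarrow> real) \<Rightarrow> ('i \<Rightarrow> real) \<Rightarrow> 'i \<Rightarrow> real" where
  "shift I w X = (\<lambda>i\<in>I. X i + w i)"

text \<open>The Cameron-Martin density: the Radon-Nikodym derivative of the law of
  \<open>X + w\<close> with respect to the law of \<open>X\<close>.\<close>

definition shift_density :: "'i set \<Rightarrow> ('i \<Rightarrow> real) \<Rightarrow> ('i \<Rightarrow> real) \<Rightarrow> real" where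
  "shift_density I w X = (\<Prod>i\<in>I. exp (w i * X i - (w i)\<^sup>2 / 2))"

lemma shift_measurable [measurable]: "shift I w \<in> gauss_PiM I \<rightarrow>\<^sub>M gauss_PiM I"
proof -
  have "shift I w \<in> (\<Pi>\<^sub>M i\<in>I. borel) \<rightarrow>\<^sub>M (\<Pi>\<^sub>M i\<in>I. borel)"
    unfolding shift_def by measurable
  then show ?thesis
    by (simp cong: measurable_cong_sets)
qed

lemma shift_density_measurable [measurable]:
  "finite I \<Longrightarrow> shift_density I w \<in> borel_measurable (gauss_PiM I)"
proof -
  have "shift_density I w \<in> borel_measurable (\<Pi>\<^sub>M i\<in>I. borel)"
    unfolding shift_density_def by measurable
  then show ?thesis
    by (simp cong: measurable_cong_sets)
qed

lemma shift_density_pos: "finite I \<Longrightarrow> shift_density I w X > 0"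
  unfolding shift_density_def by (intro prod_pos) auto

lemma shift_density_nonneg: "finite I \<Longrightarrow> 0 \<le> shift_density I w X"
  by (intro less_imp_le shift_density_pos)

text \<open>Both measures are the product of the measures \<open>density gauss (D i)\<close>, by
  uniqueness on boxes: the preimage of a box under the shift is a box, and the density factorizes
  over the coordinates.\<close>

lemma distr_shift:
  assumes I: "finite I"
  shows "distr (gauss_PiM I) (gauss_PiM I) (shift I w)
         = density (gauss_PiM I) (\<lambda>X. ennreal (shift_density I w X))"
proof -
  define D where "D = (\<lambda>i x. ennreal (exp (w i * x - (w i)\<^sup>2 / 2)))"
  have [measurable]: "D i \<in> borel_measurable borel" for i
    unfolding D_def by measurable
  have em: "emeasure (density gauss (D i)) A = emeasure gauss {x. x + w i \<in> A}" if "A \<in> sets borel" for i A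
  proof -
    have [measurable]: "A \<in> sets borel" by fact
    have "emeasure (density gauss (D i)) A = (\<integral>\<^sup>+x. D i x * indicator A x \<partial>gauss)"
      by (subst emeasure_density) auto
    also have "\<dots> = (\<integral>\<^sup>+x. indicator A (x + w i) \<partial>gauss)"
      unfolding D_def by (rule nn_integral_gauss_shift[symmetric]) measurable
    also have "\<dots> = (\<integral>\<^sup>+x. indicator {x. x + w i \<in> A} x \<partial>gauss)"
      by (intro nn_integral_cong) (auto simp: indicator_def)
    also have "\<dots> = emeasure gauss {x. x + w i \<in> A}"
      by (rule nn_integral_indicator) measurable
    finally show ?thesis .
  qed
  have ps: "prob_space (density gauss (D i))" for i
    using em[of UNIV i] gauss.emeasure_space_1 by (intro prob_spaceI) auto
  interpret Q: product_sigma_finite "\<lambda>i. density gauss (D i)"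
    using ps by (simp add: product_sigma_finite_def prob_space_imp_sigma_finite)
  have sets_eq: "sets (\<Pi>\<^sub>M i\<in>I. density gauss (D i)) = sets (gauss_PiM I)"
    unfolding gauss_PiM_def by (intro sets_PiM_cong) auto
  have "distr (gauss_PiM I) (gauss_PiM I) (shift I w) = (\<Pi>\<^sub>M i\<in>I. density gauss (D i))"
  proof (rule Q.PiM_eqI[OF I])
    fix A assume "\<And>i. i \<in> I \<Longrightarrow> A i \<in> sets (density gauss (D i))"
    then have A [measurable]: "\<And>i. i \<in> I \<Longrightarrow> A i \<in> sets borel" by simp
    have 1: "Pi\<^sub>E I A \<in> sets (gauss_PiM I)"
      using I by (simp add: sets_PiM_I_finite)
    have "emeasure (distr (gauss_PiM I) (gauss_PiM I) (shift I w)) (Pi\<^sub>E I A)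
        = emeasure (gauss_PiM I) (Pi\<^sub>E I (\<lambda>i. {x. x + w i \<in> A i}))"
      using 1 by (subst emeasure_distr)
        (auto simp: shift_def PiE_iff extensional_def intro!: arg_cong2[where f=emeasure])
    also have "\<dots> = (\<Prod>i\<in>I. emeasure gauss {x. x + w i \<in> A i})"
      unfolding gauss_PiM_def by (intro gauss_product.emeasure_PiM I) simp
    also have "\<dots> = (\<Prod>i\<in>I. emeasure (density gauss (D i)) (A i))"
      by (intro prod.cong refl em[symmetric] A)
    finally show "emeasure (distr (gauss_PiM I) (gauss_PiM I) (shift I w)) (Pi\<^sub>E I A)
      = (\<Prod>i\<in>I. emeasure (density gauss (D i)) (A i))" .
  qed (simp add: sets_eq)
  moreover have "density (gauss_PiM I) (\<lambda>X. ennreal (shift_density I w X)) = (\<Pi>\<^sub>M i\<in>I. density gauss (D i))"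
  proof (rule Q.PiM_eqI[OF I])
    fix A assume "\<And>i. i \<in> I \<Longrightarrow> A i \<in> sets (density gauss (D i))"
    then have A [measurable]: "\<And>i. i \<in> I \<Longrightarrow> A i \<in> sets borel" by simp
    have 1: "Pi\<^sub>E I A \<in> sets (gauss_PiM I)"
      using I by (simp add: sets_PiM_I_finite)
    have "emeasure (density (gauss_PiM I) (\<lambda>X. ennreal (shift_density I w X))) (Pi\<^sub>E I A)
        = (\<integral>\<^sup>+X. ennreal (shift_density I w X) * indicator (Pi\<^sub>E I A) X \<partial>gauss_PiM I)"
      using 1 I by (subst emeasure_density) auto
    also have "\<dots> = (\<integral>\<^sup>+X. (\<Prod>i\<in>I. D i (X i) * indicator (A i) (X i)) \<partial>gauss_PiM I)"
    proof (intro nn_integral_cong)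
      fix X :: "'a \<Rightarrow> real" assume "X \<in> space (gauss_PiM I)"
      \<comment> \<open>Points of the space are extensional, so membership in the box is decided
        coordinate by coordinate.\<close>
      then have "indicator (Pi\<^sub>E I A) X = (\<Prod>i\<in>I. indicator (A i) (X i) :: ennreal)"
        using I by (auto simp: indicator_def PiE_iff prod_zero_iff split: if_splits)
      then show "ennreal (shift_density I w X) * indicator (Pi\<^sub>E I A) X = (\<Prod>i\<in>I. D i (X i) * indicator (A i) (X i))"
        by (simp add: shift_density_def D_def prod.distrib prod_ennreal)
    qed
    also have "\<dots> = (\<Prod>i\<in>I. \<integral>\<^sup>+x. D i x * indicator (A i) x \<partial>gauss)"
      unfolding gauss_PiM_def by (rule gauss_product.product_nn_integral_prod[OF I]) measurable
    also have "\<dots> = (\<Prod>i\<in>I. emeasure (density gauss (D i)) (A i))"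
      by (intro prod.cong refl) (subst emeasure_density, auto)
    finally show "emeasure (density (gauss_PiM I) (\<lambda>X. ennreal (shift_density I w X))) (Pi\<^sub>E I A)
      = (\<Prod>i\<in>I. emeasure (density gauss (D i)) (A i))" .
  qed (simp add: sets_eq)
  ultimately show ?thesis by simp
qed

text \<open>The density of the shifted law is strictly positive, so both laws have the same null
  sets.\<close>

lemma AE_shift:
  assumes "finite I" and "{X \<in> space (gauss_PiM I). P X} \<in> sets (gauss_PiM I)"
  shows "(AE X in gauss_PiM I. P (shift I w X)) \<longleftrightarrow> (AE X in gauss_PiM I. P X)"
proof -
  have "(AE X in gauss_PiM I. P (shift I w X)) \<longleftrightarrow> (AE X in distr (gauss_PiM I) (gauss_PiM I) (shift I w). P X)"
    using assms(2) by (subst AE_distr_iff) auto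
  also have "\<dots> \<longleftrightarrow> (AE X in gauss_PiM I. P X)"
    unfolding distr_shift[OF assms(1)] using assms(1)
    by (subst AE_density) (auto simp: shift_density_pos)
  finally show ?thesis .
qed

lemma nn_integral_shift_density:
  assumes "finite I"
  shows "(\<integral>\<^sup>+X. ennreal (shift_density I w X) \<partial>gauss_PiM I) = 1"
proof -
  interpret P: prob_space "distr (gauss_PiM I) (gauss_PiM I) (shift I w)"
    by (intro prob_space.prob_space_distr prob_space_gauss_PiM) measurable
  have "(\<integral>\<^sup>+X. ennreal (shift_density I w X) \<partial>gauss_PiM I)
      = emeasure (density (gauss_PiM I) (\<lambda>X. ennreal (shift_density I w X))) (space (gauss_PiM I))"
    using assms sets.top[of "gauss_PiM I"]
    by (subst emeasure_density) (auto intro!: nn_integral_cong)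
  also have "\<dots> = 1"
    using P.emeasure_space_1 unfolding distr_shift[OF assms] by simp
  finally show ?thesis .
qed

text \<open>The square is again a density of a shift, up to a constant factor. As the density for
  \<open>2 * w\<close> integrates to 1, the constant is the second moment.\<close>

lemma shift_density_square:
  "(shift_density I w X)\<^sup>2 = exp (\<Sum>i\<in>I. (w i)\<^sup>2) * shift_density I (\<lambda>i. 2 * w i) X"
proof (cases "finite I")
  case True
  then show ?thesis
    by (simp add: shift_density_def exp_sum exp_add[symmetric] power2_eq_square
        prod.distrib[symmetric] algebra_simps)
qed (simp add: shift_density_def)

lemma integral_shift_density:
  assumes "finite I"
  shows "integrable (gauss_PiM I) (shift_density I w)"
    and "(\<integral>X. shift_density I w X \<partial>gauss_PiM I) = 1"
proof -
  show "integrable (gauss_PiM I) (shift_density I w)"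
    using assms nn_integral_shift_density[OF assms, of w]
    by (intro integrableI_nonneg) (auto intro!: AE_I2 shift_density_nonneg)
  show "(\<integral>X. shift_density I w X \<partial>gauss_PiM I) = 1"
    using assms nn_integral_shift_density[OF assms, of w]
    by (subst integral_eq_nn_integral) (auto intro!: AE_I2 shift_density_nonneg)
qed

text \<open>The chi-square divergence \<open>exp \<parallel>w\<parallel>\<^sup>2 - 1\<close> controls the total variation through
  \<open>D - 1 \<le> \<delta>/2 + (D - 1)\<^sup>2/(2\<delta>)\<close>; the bound is linear in \<open>\<parallel>w\<parallel>\<^sup>2\<close>, so that it can be averaged.\<close>

lemma gauss_shift_total_variation:
  assumes I: "finite I" and A: "A \<in> sets (gauss_PiM I)" and \<delta>: "0 < \<delta>" "\<delta> \<le> 1"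
  shows "measure (gauss_PiM I) {X \<in> space (gauss_PiM I). shift I w X \<in> A} - measure (gauss_PiM I) A
         \<le> \<delta> / 2 + (\<Sum>i\<in>I. (w i)\<^sup>2) / \<delta>"
proof -
  let ?G = "gauss_PiM I" and ?D = "shift_density I w" and ?s = "\<Sum>i\<in>I. (w i)\<^sup>2"
  interpret G: prob_space ?G by (rule prob_space_gauss_PiM)
  have s0: "?s \<ge> 0" by (intro sum_nonneg) auto
  show ?thesis
  proof (cases "?s \<le> 1")
    case False
    \<comment> \<open>For a large shift the claim is trivial: a difference of probabilities is at
      most 1.\<close>
    then have "1 \<le> ?s / \<delta>" using \<delta> by (simp add: le_divide_eq)
    moreover have "measure ?G {X \<in> space ?G. shift I w X \<in> A} \<le> 1" by simp
    moreover have "measure ?G A \<ge> 0" by simp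
    ultimately show ?thesis using \<delta> by linarith
  next
    case True
    note D = integral_shift_density[OF I, of w]
    note D2 = integral_shift_density[OF I, of "\<lambda>i. 2 * w i"]
    have iA: "integrable ?G (\<lambda>X. ?D X * indicator A X)"
      using integrable_mult_indicator[OF A D(1)] by (simp add: mult.commute)
    have iA': "integrable ?G (indicator A :: _ \<Rightarrow> real)"
      using A by (intro integrable_real_indicator) (auto simp: G.emeasure_eq_measure simp del: sets_gauss_PiM)
    have "emeasure ?G {X \<in> space ?G. shift I w X \<in> A} = emeasure (distr ?G ?G (shift I w)) A"
      using A by (subst emeasure_distr) (auto intro!: arg_cong2[where f=emeasure])
    also have "\<dots> = (\<integral>\<^sup>+X. ennreal (?D X * indicator A X) \<partial>?G)"
      unfolding distr_shift[OF I] using A I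
      by (subst emeasure_density) (auto intro!: nn_integral_cong simp: indicator_def)
    also have "\<dots> = ennreal (\<integral>X. ?D X * indicator A X \<partial>?G)"
      using iA I by (intro nn_integral_eq_integral) (auto intro!: AE_I2 mult_nonneg_nonneg shift_density_nonneg)
    finally have "measure ?G {X \<in> space ?G. shift I w X \<in> A} = (\<integral>X. ?D X * indicator A X \<partial>?G)"
      unfolding measure_def using I
      by (simp add: integral_nonneg_AE shift_density_nonneg)
    moreover have "measure ?G A = (\<integral>X. indicator A X \<partial>?G)"
      using sets.sets_into_space[OF A] by (simp add: Int_absorb2)
    ultimately have "measure ?G {X \<in> space ?G. shift I w X \<in> A} - measure ?G A
        = (\<integral>X. ?D X * indicator A X - indicator A X \<partial>?G)"
      using iA iA' by (subst Bochner_Integration.integral_diff) auto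
    \<comment> \<open>The integrand on the right is
      \<open>\<delta> / 2 + (D - 1)^2 / (2 * \<delta>)\<close> with the square expanded by
      \<open>shift_density_square\<close>, so each term has a known integral. It dominates
      \<open>D - 1\<close> on \<open>A\<close> and 0 off \<open>A\<close>.\<close>
    also have "\<dots> \<le> (\<integral>X. \<delta> / 2 + (exp ?s * shift_density I (\<lambda>i. 2 * w i) X - 2 * ?D X + 1) / (2 * \<delta>) \<partial>?G)"
    proof (intro integral_mono)
      fix X
      have "0 \<le> (\<delta> - (?D X - 1))\<^sup>2" "0 \<le> (\<delta> + (?D X - 1))\<^sup>2" by simp_all
      then have "?D X - 1 \<le> \<delta> / 2 + (?D X - 1)\<^sup>2 / (2 * \<delta>)" "0 \<le> \<delta> / 2 + (?D X - 1)\<^sup>2 / (2 * \<delta>)"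
        using \<delta> by (auto simp: field_simps power2_eq_square)
      then show "?D X * indicator A X - indicator A X
          \<le> \<delta> / 2 + (exp ?s * shift_density I (\<lambda>i. 2 * w i) X - 2 * ?D X + 1) / (2 * \<delta>)"
        unfolding shift_density_square[symmetric]
        by (auto simp: indicator_def power2_diff algebra_simps)
    next
      show "integrable ?G (\<lambda>X. ?D X * indicator A X - indicator A X)"
        using iA iA' by auto
      show "integrable ?G (\<lambda>X. \<delta> / 2 + (exp ?s * shift_density I (\<lambda>i. 2 * w i) X - 2 * ?D X + 1) / (2 * \<delta>))"
        using D(1) D2(1) by auto
    qed
    also have "\<dots> = \<delta> / 2 + (exp ?s - 1) / (2 * \<delta>)"
      using D D2 G.prob_space by simp
    also have "\<dots> \<le> \<delta> / 2 + ?s / \<delta>"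
    proof -
      have "exp ?s - 1 \<le> 2 * ?s"
        using exp_bound[OF s0 True] mult_left_mono[OF True s0] by (simp add: power2_eq_square)
      then have "(exp ?s - 1) / (2 * \<delta>) \<le> 2 * ?s / (2 * \<delta>)"
        using \<delta> by (intro divide_right_mono) auto
      then show ?thesis by simp
    qed
    finally show ?thesis .
  qed
qed

lemma gauss_PiM_component_measurable:
  "i \<in> I \<Longrightarrow> (\<lambda>X. X i) \<in> borel_measurable (gauss_PiM I)"
  by (simp cong: measurable_cong_sets)

section \<open>Projections to the row space of a linear map\<close>

text \<open>Gram-Schmidt, by induction on the number of vectors. That the \<open>l b\<close> lie in
  the span of the \<open>u a\<close> is expressed dually: what is orthogonal to every
  \<open>u a\<close> is orthogonal to every \<open>l b\<close>. Linear dependence is the reason for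
  \<open>k' \<le> k\<close>.\<close>

lemma exists_orthonormal_spanning:
  fixes l :: "nat \<Rightarrow> 'i \<Rightarrow> real"
  assumes I: "finite I"
  shows "\<exists>u k'. k' \<le> k \<and>
    (\<forall>a<k'. \<forall>b<k'. (\<Sum>i\<in>I. u a i * u b i) = (if a = b then 1 else 0)) \<and>
    (\<forall>z. (\<forall>a<k'. (\<Sum>i\<in>I. z i * u a i) = 0) \<longrightarrow> (\<forall>b<k. (\<Sum>i\<in>I. z i * l b i) = 0))"
proof (induction k)
  case 0
  show ?case by auto
next
  case (Suc k)
  then obtain u :: "nat \<Rightarrow> 'i \<Rightarrow> real" and k' where k': "k' \<le> k"
    and on: "\<And>a b. a < k' \<Longrightarrow> b < k' \<Longrightarrow> (\<Sum>i\<in>I. u a i * u b i) = (if a = b then 1 else 0)"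
    and sp: "\<And>z b. (\<And>a. a < k' \<Longrightarrow> (\<Sum>i\<in>I. z i * u a i) = 0) \<Longrightarrow> b < k \<Longrightarrow> (\<Sum>i\<in>I. z i * l b i) = 0"
    by blast
  define c where "c a = (\<Sum>i\<in>I. l k i * u a i)" for a
  \<comment> \<open>The residual of \<open>l k\<close> after projection to the span found so far. If
    it vanishes, the old system is kept; otherwise its normalization is appended.\<close>
  define e where "e i = l k i - (\<Sum>a<k'. c a * u a i)" for i
  have e_orth: "(\<Sum>i\<in>I. e i * u b i) = 0" if b: "b < k'" for b
  proof -
    have "(\<Sum>i\<in>I. (\<Sum>a<k'. c a * u a i) * u b i) = (\<Sum>a<k'. c a * (\<Sum>i\<in>I. u a i * u b i))"
      by (simp add: sum_distrib_left sum_distrib_right mult.assoc) (rule sum.swap)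
    also have "\<dots> = (\<Sum>a<k'. if a = b then c b else 0)"
      using on b by (intro sum.cong) auto
    also have "\<dots> = c b"
      using b by simp
    finally show ?thesis
      by (simp add: e_def left_diff_distrib sum_subtractf c_def)
  qed
  have lk: "(\<Sum>i\<in>I. z i * l k i) = (\<Sum>i\<in>I. z i * e i)"
    if "\<And>a. a < k' \<Longrightarrow> (\<Sum>i\<in>I. z i * u a i) = 0" for z
  proof -
    have "(\<Sum>i\<in>I. z i * (\<Sum>a<k'. c a * u a i)) = (\<Sum>a<k'. c a * (\<Sum>i\<in>I. z i * u a i))"
      by (simp add: sum_distrib_left mult.left_commute) (rule sum.swap)
    then show ?thesis
      using that by (simp add: e_def right_diff_distrib sum_subtractf)
  qed
  define s where "s = (\<Sum>i\<in>I. e i * e i)"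
  have s0: "s \<ge> 0" unfolding s_def by (intro sum_nonneg) auto
  show ?case
  proof (cases "s = 0")
    case True
    then have "e i = 0" if "i \<in> I" for i
      using that I sum_nonneg_eq_0_iff[of I "\<lambda>i. e i * e i"] by (simp add: s_def)
    then have "(\<Sum>i\<in>I. z i * l b i) = 0"
      if "\<And>a. a < k' \<Longrightarrow> (\<Sum>i\<in>I. z i * u a i) = 0" "b < Suc k" for z b
      using sp[of z b] lk[of z] that by (cases "b = k") auto
    then show ?thesis
      using k' on by (intro exI[of _ u] exI[of _ k']) auto
  next
    case False
    define u' where "u' a i = (if a < k' then u a i else e i / sqrt s)" for a i
    have "(\<Sum>i\<in>I. u' a i * u' b i) = (if a = b then 1 else 0)" if "a < Suc k'" "b < Suc k'" for a b
    proof -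
      have ss: "(\<Sum>i\<in>I. e i * e i / s) = 1"
        using False by (simp add: sum_divide_distrib[symmetric] s_def)
      have 1: "(\<Sum>i\<in>I. e i / sqrt s * (e i / sqrt s)) = 1"
        using s0 ss by simp
      have 2: "(\<Sum>i\<in>I. e i / sqrt s * u b i) = 0" if "b < k'" for b
        using e_orth[OF that] by (simp add: sum_divide_distrib[symmetric])
      have 3: "(\<Sum>i\<in>I. u b i * (e i / sqrt s)) = 0" if "b < k'" for b
        using 2[OF that] by (simp add: mult.commute)
      show ?thesis
        using that on 1 2 3 unfolding u'_def by (cases "a < k'"; cases "b < k'") auto
    qed
    moreover have "(\<Sum>i\<in>I. z i * l b i) = 0"
      if *: "\<And>a. a < Suc k' \<Longrightarrow> (\<Sum>i\<in>I. z i * u' a i) = 0" and b: "b < Suc k" for z b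
    proof -
      have 1: "(\<Sum>i\<in>I. z i * u a i) = 0" if "a < k'" for a
        using *[of a] that by (simp add: u'_def)
      have "(\<Sum>i\<in>I. z i * e i) / sqrt s = 0"
        using *[of k'] by (simp add: u'_def sum_divide_distrib)
      then have "(\<Sum>i\<in>I. z i * e i) = 0" using False by simp
      then show ?thesis
        using sp[OF 1] lk[OF 1] b by (cases "b = k") auto
    qed
    ultimately show ?thesis
      using k' by (intro exI[of _ u'] exI[of _ "Suc k'"]) auto
  qed
qed

text \<open>Row \<open>j\<close> of \<open>W\<close> is the orthogonal projection of the \<open>j\<close>-th unit vector to the span of
  \<open>l 0, \<dots>, l (k - 1)\<close>, so the squared norms of the rows add up to the trace, i.e. the rank, of
  the projection.\<close>

lemma exists_row_space_projection:
  fixes l :: "nat \<Rightarrow> 'i \<Rightarrow> real"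
  assumes I: "finite I"
  obtains W :: "'i \<Rightarrow> 'i \<Rightarrow> real"
  where "\<And>j b. j \<in> I \<Longrightarrow> b < k \<Longrightarrow> (\<Sum>i\<in>I. W j i * l b i) = l b j"
    and "(\<Sum>j\<in>I. \<Sum>i\<in>I. (W j i)\<^sup>2) \<le> real k"
proof -
  from exists_orthonormal_spanning[OF I, of k l]
  obtain u :: "nat \<Rightarrow> 'i \<Rightarrow> real" and k' where k': "k' \<le> k"
    and on: "\<And>a b. a < k' \<Longrightarrow> b < k' \<Longrightarrow> (\<Sum>i\<in>I. u a i * u b i) = (if a = b then 1 else 0)"
    and sp: "\<And>z b. (\<And>a. a < k' \<Longrightarrow> (\<Sum>i\<in>I. z i * u a i) = 0) \<Longrightarrow> b < k \<Longrightarrow> (\<Sum>i\<in>I. z i * l b i) = 0"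
    by blast
  define W where "W j i = (\<Sum>a<k'. u a j * u a i)" for j i
  have Wu: "(\<Sum>i\<in>I. W j i * u b i) = u b j" if b: "b < k'" for j b
  proof -
    have "(\<Sum>i\<in>I. W j i * u b i) = (\<Sum>a<k'. u a j * (\<Sum>i\<in>I. u a i * u b i))"
      by (simp add: W_def sum_distrib_left sum_distrib_right mult.assoc) (rule sum.swap)
    also have "\<dots> = (\<Sum>a<k'. if a = b then u b j else 0)"
      using on b by (intro sum.cong) auto
    also have "\<dots> = u b j"
      using b by simp
    finally show ?thesis .
  qed
  have "(\<Sum>i\<in>I. W j i * l b i) = l b j" if j: "j \<in> I" and b: "b < k" for j b
  proof -
    \<comment> \<open>The unit vector at \<open>j\<close> minus its projection is orthogonal to
      every \<open>u a\<close>, hence to \<open>l b\<close>.\<close>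
    have "(\<Sum>i\<in>I. ((if i = j then 1 else 0) - W j i) * l b i) = 0"
      by (rule sp[OF _ b]) (use I j Wu in \<open>simp add: left_diff_distrib sum_subtractf sum.delta mult_delta_left\<close>)
    then show ?thesis
      using I j by (simp add: left_diff_distrib sum_subtractf sum.delta mult_delta_left)
  qed
  moreover have "(\<Sum>j\<in>I. \<Sum>i\<in>I. (W j i)\<^sup>2) = real k'"
  proof -
    have "(\<Sum>i\<in>I. (W j i)\<^sup>2) = (\<Sum>a<k'. u a j * u a j)" for j
    proof -
      have "(\<Sum>i\<in>I. (W j i)\<^sup>2) = (\<Sum>i\<in>I. \<Sum>a<k'. u a j * (W j i * u a i))"
        by (simp add: power2_eq_square W_def[of j] sum_distrib_left mult_ac)
      also have "\<dots> = (\<Sum>a<k'. u a j * (\<Sum>i\<in>I. W j i * u a i))"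
        by (subst sum.swap) (simp add: sum_distrib_left)
      finally show ?thesis by (simp add: Wu)
    qed
    then have "(\<Sum>j\<in>I. \<Sum>i\<in>I. (W j i)\<^sup>2) = (\<Sum>a<k'. \<Sum>j\<in>I. u a j * u a j)"
      by (simp add: sum.swap[of _ I])
    then show ?thesis using on by simp
  qed
  ultimately show ?thesis
    using k' that[of W] by simp
qed

section \<open>Bounding the norm on integer vectors\<close>

text \<open>If \<open>a\<close> or \<open>b\<close> is 0, the claim reduces to
  \<open>c powr p \<le> c\<close> for \<open>0 < c < 1\<close>; otherwise it is convexity on the
  positive reals.\<close>

lemma powr_convex_nonneg:
  fixes a b t p :: real
  assumes p: "p \<ge> 1" and ab: "0 \<le> a" "0 \<le> b" and t: "0 < t" "t < 1"
  shows "((1 - t) * a + t * b) powr p \<le> (1 - t) * a powr p + t * b powr p"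
proof -
  have le: "c powr p \<le> c" if "0 < c" "c < 1" for c :: real
    using powr_mono'[of 1 p c] that p by simp
  show ?thesis
  proof (cases "a = 0 \<or> b = 0")
    case True
    then show ?thesis
      using le[of t] le[of "1 - t"] t ab by (auto simp: powr_mult intro!: mult_right_mono)
  next
    case False
    then show ?thesis
      using convex_onD[OF powr_convex[OF p], of t a b] t ab by simp
  qed
qed

lemma abs_powr_convex:
  assumes "p \<ge> 1"
  shows "convex_on UNIV (\<lambda>t::real. \<bar>a + b * t\<bar> powr p)"
proof (intro convex_onI)
  fix t x y :: real assume t: "0 < t" "t < 1"
  have "\<bar>a + b * ((1 - t) *\<^sub>R x + t *\<^sub>R y)\<bar> = \<bar>(1 - t) * (a + b * x) + t * (a + b * y)\<bar>"
    by (simp add: algebra_simps)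
  also have "\<dots> \<le> (1 - t) * \<bar>a + b * x\<bar> + t * \<bar>a + b * y\<bar>"
    using t abs_triangle_ineq[of "(1 - t) * (a + b * x)" "t * (a + b * y)"] by (simp add: abs_mult)
  finally have "\<bar>a + b * ((1 - t) *\<^sub>R x + t *\<^sub>R y)\<bar> powr p
      \<le> ((1 - t) * \<bar>a + b * x\<bar> + t * \<bar>a + b * y\<bar>) powr p"
    using assms by (intro powr_mono2) auto
  also have "\<dots> \<le> (1 - t) * \<bar>a + b * x\<bar> powr p + t * \<bar>a + b * y\<bar> powr p"
    using t by (intro powr_convex_nonneg assms) auto
  finally show "\<bar>a + b * ((1 - t) *\<^sub>R x + t *\<^sub>R y)\<bar> powr p
      \<le> (1 - t) * \<bar>a + b * x\<bar> powr p + t * \<bar>a + b * y\<bar> powr p" .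
qed simp

text \<open>A convex function on the segment between two neighbouring integers is bounded by its
  larger endpoint value. So the coordinates can be rounded one after another, each up or down as
  \<open>F\<close> dictates, without decreasing \<open>F\<close>.\<close>

lemma convex_rounding:
  fixes F :: "(nat \<Rightarrow> real) \<Rightarrow> real"
  assumes F: "\<And>j z. convex_on UNIV (\<lambda>t. F (z(j := t)))"
  shows "\<exists>y :: nat \<Rightarrow> int. (\<forall>j<r. \<bar>real_of_int (y j) - z j\<bar> \<le> 1) \<and>
           F z \<le> F (\<lambda>j. if j < r then real_of_int (y j) else z j)"
proof (induction r)
  case 0
  show ?case by simp
next
  case (Suc r)
  then obtain y :: "nat \<Rightarrow> int" where y: "\<And>j. j < r \<Longrightarrow> \<bar>real_of_int (y j) - z j\<bar> \<le> 1"
    and Fy: "F z \<le> F (\<lambda>j. if j < r then real_of_int (y j) else z j)" by blast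
  define z' where "z' = (\<lambda>j. if j < r then real_of_int (y j) else z j)"
  define v where "v = z r - of_int \<lfloor>z r\<rfloor>"
  have v: "0 \<le> v" "v \<le> 1" unfolding v_def by linarith+
  have zr: "(1 - v) *\<^sub>R real_of_int \<lfloor>z r\<rfloor> + v *\<^sub>R (real_of_int \<lfloor>z r\<rfloor> + 1) = z r"
    by (simp add: v_def algebra_simps)
  have "F z' = F (z'(r := z r))"
    by (simp add: z'_def fun_upd_idem)
  also have "\<dots> \<le> max (F (z'(r := real_of_int \<lfloor>z r\<rfloor>))) (F (z'(r := real_of_int \<lfloor>z r\<rfloor> + 1)))"
    using convex_lower[OF F[of z' r], of "real_of_int \<lfloor>z r\<rfloor>" "real_of_int \<lfloor>z r\<rfloor> + 1" "1 - v" v] v zr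
    by simp
  finally obtain c :: int where c: "c = \<lfloor>z r\<rfloor> \<or> c = \<lfloor>z r\<rfloor> + 1" and Fc: "F z' \<le> F (z'(r := real_of_int c))"
    by (metis max_def of_int_1 of_int_add)
  have eq: "z'(r := real_of_int c) = (\<lambda>j. if j < Suc r then real_of_int ((y(r := c)) j) else z j)"
    by (auto simp: z'_def)
  have cz: "\<bar>real_of_int c - z r\<bar> \<le> 1" using c by linarith
  have "\<forall>j<Suc r. \<bar>real_of_int ((y(r := c)) j) - z j\<bar> \<le> 1"
    using y cz by (auto simp: less_Suc_eq)
  moreover have "F z \<le> F (\<lambda>j. if j < Suc r then real_of_int ((y(r := c)) j) else z j)"
    using Fy Fc unfolding eq[symmetric] z'_def by linarith
  ultimately show ?case by blast
qed

lemma convex_on_sum_fun: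
  assumes "convex S" "\<And>i. i \<in> A \<Longrightarrow> convex_on S (f i)"
  shows "convex_on S (\<lambda>x. \<Sum>i\<in>A. f i x)"
  using assms
  by (induction A rule: infinite_finite_induct) (auto simp: convex_on_const intro: convex_on_add)

text \<open>The sum is convex in each coordinate of \<open>z\<close>, so rounding does not decrease
  it. Each coordinate moves by at most 1, whence \<open>(y j)^2 \<le> 2 * (z j)^2 + 2\<close>, and
  these bounds add up to at most \<open>4 * r\<close>.\<close>

lemma powr_sum_le_of_integer_points:
  fixes X :: "nat \<times> nat \<Rightarrow> real" and B q :: real
  assumes q: "q \<ge> 1"
    and bound: "\<And>y :: nat \<Rightarrow> int. (\<Sum>j<r. (y j)\<^sup>2) \<le> 4 * int r \<Longrightarrow>
      (\<Sum>i<n. \<bar>\<Sum>j<r. X (i, j) * real_of_int (y j)\<bar> powr q) \<le> B"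
    and z: "(\<Sum>j<r. (z j)\<^sup>2) \<le> real r"
  shows "(\<Sum>i<n. \<bar>\<Sum>j<r. X (i, j) * z j\<bar> powr q) \<le> B"
proof -
  define F where "F z = (\<Sum>i<n. \<bar>\<Sum>j<r. X (i, j) * z j\<bar> powr q)" for z :: "nat \<Rightarrow> real"
  have conv: "convex_on UNIV (\<lambda>t. F (z(j := t)))" for j z
  proof -
    have "convex_on UNIV (\<lambda>t. \<bar>\<Sum>j'<r. X (i, j') * (z(j := t)) j'\<bar> powr q)" for i
    proof (cases "j < r")
      case True
      have "(\<Sum>j'<r. X (i, j') * (z(j := t)) j') = (\<Sum>j'\<in>{..<r}-{j}. X (i, j') * z j') + X (i, j) * t" for t
        using True by (subst sum.remove[of _ j]) (auto intro!: sum.cong)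
      then show ?thesis
        using abs_powr_convex[OF q] by simp
    next
      case False
      then have "(\<Sum>j'<r. X (i, j') * (z(j := t)) j') = (\<Sum>j'<r. X (i, j') * z j') + 0 * t" for t
        by (auto intro!: sum.cong)
      then show ?thesis
        by (simp only: abs_powr_convex[OF q])
    qed
    then show ?thesis
      unfolding F_def by (intro convex_on_sum_fun) auto
  qed
  obtain y :: "nat \<Rightarrow> int" where y: "\<And>j. j < r \<Longrightarrow> \<bar>real_of_int (y j) - z j\<bar> \<le> 1"
    and Fy: "F z \<le> F (\<lambda>j. if j < r then real_of_int (y j) else z j)"
    using convex_rounding[of F r z, OF conv] by blast
  have "(real_of_int (y j))\<^sup>2 \<le> 2 * (z j)\<^sup>2 + 2" if "j < r" for j
  proof -
    have "(real_of_int (y j))\<^sup>2 = (z j + (real_of_int (y j) - z j))\<^sup>2" by simp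
    also have "\<dots> \<le> 2 * (z j)\<^sup>2 + 2 * (real_of_int (y j) - z j)\<^sup>2"
      using sum_squares_bound[of "z j" "real_of_int (y j) - z j"] unfolding power2_sum by linarith
    also have "(real_of_int (y j) - z j)\<^sup>2 \<le> 1"
      using y[OF that] by (simp add: abs_square_le_1)
    finally show ?thesis by simp
  qed
  then have "(\<Sum>j<r. (real_of_int (y j))\<^sup>2) \<le> (\<Sum>j<r. 2 * (z j)\<^sup>2 + 2)"
    by (intro sum_mono) auto
  also have "\<dots> \<le> 4 * real r"
    using z by (simp add: sum.distrib sum_distrib_left[symmetric])
  finally have "real_of_int (\<Sum>j<r. (y j)\<^sup>2) \<le> real_of_int (4 * int r)" by simp
  then have "(\<Sum>j<r. (y j)\<^sup>2) \<le> 4 * int r" by (simp only: of_int_le_iff)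
  from bound[OF this] Fy show ?thesis
    by (simp add: F_def)
qed

section \<open>Matrices padded by zero columns and their \<open>2 \<rightarrow> q\<close>
  norm\<close>

definition pad_mat :: "nat \<Rightarrow> nat \<Rightarrow> nat \<Rightarrow> (nat \<times> nat \<Rightarrow> real) \<Rightarrow> real mat" where
  "pad_mat n m r X = mat n m (\<lambda>(i, j). if j < r then X (i, j) else 0)"

lemma pad_mat_carrier [simp]: "pad_mat n m r X \<in> carrier_mat n m"
  by (simp add: pad_mat_def)

lemma lp_norm_2: "lp_norm 2 x = sqrt (\<Sum>j<dim_vec x. (x $ j)\<^sup>2)"
  by (simp add: lp_norm_def powr_half_sqrt sum_nonneg)

lemma lp_norm_2_pos:
  assumes "x \<in> carrier_vec m" "x \<noteq> 0\<^sub>v m"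
  shows "lp_norm 2 x > 0"
proof -
  obtain j where j: "j < m" "x $ j \<noteq> 0"
    using assms by (metis carrier_vecD dim_vec index_zero_vec(1) eq_vecI zero_carrier_vec)
  have "0 < (\<Sum>j<m. (x $ j)\<^sup>2)"
    using j by (intro sum_pos2[of _ j]) auto
  then show ?thesis
    using assms by (simp add: lp_norm_2)
qed

lemma index_pad_mat_mult_vec:
  assumes "r \<le> m" "x \<in> carrier_vec m" "i < n"
  shows "(pad_mat n m r X *\<^sub>v x) $ i = (\<Sum>j<r. X (i, j) * x $ j)"
proof -
  have "(pad_mat n m r X *\<^sub>v x) $ i = (\<Sum>j<m. (if j < r then X (i, j) else 0) * x $ j)"
    using assms by (auto simp: pad_mat_def scalar_prod_def lessThan_atLeast0 intro!: sum.cong)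
  also have "\<dots> = (\<Sum>j<r. X (i, j) * x $ j)"
    using assms by (intro sum.mono_neutral_cong_right) auto
  finally show ?thesis .
qed

text \<open>Scaling \<open>x\<close> to norm \<open>sqrt r\<close> brings its first \<open>r\<close>
  coordinates into the range of \<open>powr_sum_le_of_integer_points\<close>; by homogeneity the
  bound \<open>B\<close> there becomes \<open>B / sqrt r\<close> for the quotient.\<close>

lemma two_to_norm_quotient_le:
  fixes X :: "nat \<times> nat \<Rightarrow> real" and B q :: real
  assumes q: "q \<ge> 1" and B: "B \<ge> 0" and r: "1 \<le> r" "r \<le> m"
    and bound: "\<And>y :: nat \<Rightarrow> int. (\<Sum>j<r. (y j)\<^sup>2) \<le> 4 * int r \<Longrightarrow>
      (\<Sum>i<n. \<bar>\<Sum>j<r. X (i, j) * real_of_int (y j)\<bar> powr q) \<le> B powr q"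
    and x: "x \<in> carrier_vec m" "x \<noteq> 0\<^sub>v m"
  shows "lp_norm q (pad_mat n m r X *\<^sub>v x) / lp_norm 2 x \<le> B / sqrt (real r)"
proof -
  define s where "s = lp_norm 2 x"
  have s: "s > 0" unfolding s_def by (rule lp_norm_2_pos[OF x])
  have s2: "s\<^sup>2 = (\<Sum>j<m. (x $ j)\<^sup>2)"
    using x by (simp add: s_def lp_norm_2 sum_nonneg)
  define z where "z j = sqrt (real r) * x $ j / s" for j
  have "(\<Sum>j<r. (z j)\<^sup>2) = real r * (\<Sum>j<r. (x $ j)\<^sup>2) / s\<^sup>2"
    by (simp add: z_def power_divide power_mult_distrib sum_distrib_left sum_divide_distrib)
  also have "\<dots> \<le> real r * s\<^sup>2 / s\<^sup>2"
    unfolding s2 using r by (intro divide_right_mono mult_left_mono sum_mono2 sum_nonneg) auto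
  also have "\<dots> = real r" using s by simp
  finally have z: "(\<Sum>j<r. (z j)\<^sup>2) \<le> real r" .
  have "(\<Sum>i<n. \<bar>(pad_mat n m r X *\<^sub>v x) $ i\<bar> powr q)
      = (\<Sum>i<n. (s / sqrt (real r)) powr q * \<bar>\<Sum>j<r. X (i, j) * z j\<bar> powr q)"
  proof (intro sum.cong refl)
    fix i assume "i \<in> {..<n}"
    then have "(pad_mat n m r X *\<^sub>v x) $ i = (\<Sum>j<r. X (i, j) * x $ j)"
      using x r by (simp add: index_pad_mat_mult_vec)
    also have "\<dots> = s / sqrt (real r) * (\<Sum>j<r. X (i, j) * z j)"
      unfolding sum_distrib_left using s r by (intro sum.cong refl) (simp add: z_def)
    finally have "\<bar>(pad_mat n m r X *\<^sub>v x) $ i\<bar> = s / sqrt (real r) * \<bar>\<Sum>j<r. X (i, j) * z j\<bar>"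
      using s by (simp add: abs_mult)
    then show "\<bar>(pad_mat n m r X *\<^sub>v x) $ i\<bar> powr q
        = (s / sqrt (real r)) powr q * \<bar>\<Sum>j<r. X (i, j) * z j\<bar> powr q"
      using s by (simp only: powr_mult)
  qed
  also have "\<dots> \<le> (s / sqrt (real r)) powr q * B powr q"
    using powr_sum_le_of_integer_points[OF q bound z]
    by (simp add: sum_distrib_left[symmetric] mult_left_mono)
  also have "\<dots> = (s / sqrt (real r) * B) powr q"
    using s B by (subst powr_mult) auto
  finally have "lp_norm q (pad_mat n m r X *\<^sub>v x) \<le> ((s / sqrt (real r) * B) powr q) powr (1 / q)"
    unfolding lp_norm_def using q by (auto simp: pad_mat_def intro!: powr_mono2 sum_nonneg)
  also have "\<dots> = s / sqrt (real r) * B"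
    using q s B by (simp add: powr_powr)
  finally show ?thesis
    using s unfolding s_def[symmetric] by (simp add: field_simps)
qed

lemma two_to_norm_pad_mat_le:
  fixes X :: "nat \<times> nat \<Rightarrow> real" and B q :: real
  assumes q: "q \<ge> 1" and B: "B \<ge> 0" and r: "1 \<le> r" "r \<le> m"
    and bound: "\<And>y :: nat \<Rightarrow> int. (\<Sum>j<r. (y j)\<^sup>2) \<le> 4 * int r \<Longrightarrow>
      (\<Sum>i<n. \<bar>\<Sum>j<r. X (i, j) * real_of_int (y j)\<bar> powr q) \<le> B powr q"
  shows "two_to_norm q (pad_mat n m r X) \<le> B / sqrt (real r)"
proof -
  \<comment> \<open>The supremum can be bounded from above only over a nonempty set.\<close>
  have "unit_vec m 0 \<in> {x \<in> carrier_vec m. x \<noteq> 0\<^sub>v m}"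
    using r by simp
  then have "{x \<in> carrier_vec m. x \<noteq> (0\<^sub>v m :: real vec)} \<noteq> {}"
    by blast
  then show ?thesis
    unfolding two_to_norm_def
    using two_to_norm_quotient_le[OF assms] by (intro cSUP_least) (auto simp: pad_mat_def)
qed

lemma abs_le_square_int: "\<bar>a\<bar> \<le> a\<^sup>2" for a :: int
proof -
  have "\<bar>a\<bar> * 1 \<le> \<bar>a\<bar> * \<bar>a\<bar>"
    by (cases "a = 0") (auto intro!: mult_left_mono simp del: abs_mult_self_eq)
  then show ?thesis by (simp add: power2_eq_square)
qed

text \<open>The quotient at the \<open>j\<close>-th unit vector is at least the modulus of the
  entry. Most of the proof shows that the quotients are bounded above, so that the supremum really
  dominates this one.\<close>

lemma abs_entry_le_two_to_norm:
  fixes X :: "nat \<times> nat \<Rightarrow> real" and q :: real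
  assumes q: "q \<ge> 1" and r: "r \<le> m" and ij: "i < n" "j < r"
  shows "\<bar>X (i, j)\<bar> \<le> two_to_norm q (pad_mat n m r X)"
proof -
  \<comment> \<open>A crude bound suffices here: integer vectors with square sum at most
    \<open>4 * r\<close> have coordinates of modulus at most \<open>4 * r\<close>.\<close>
  define B where "B = (\<Sum>i<n. (\<Sum>j<r. \<bar>X (i, j)\<bar> * (4 * real r)) powr q) powr (1 / q)"
  have B: "B \<ge> 0" by (simp add: B_def)
  have Bq: "B powr q = (\<Sum>i<n. (\<Sum>j<r. \<bar>X (i, j)\<bar> * (4 * real r)) powr q)"
    using q by (simp add: B_def powr_powr sum_nonneg)
  have bound: "(\<Sum>i<n. \<bar>\<Sum>j<r. X (i, j) * real_of_int (y j)\<bar> powr q) \<le> B powr q"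
    if y: "(\<Sum>j<r. (y j)\<^sup>2) \<le> 4 * int r" for y :: "nat \<Rightarrow> int"
    unfolding Bq
  proof (intro sum_mono powr_mono2)
    fix i
    have "\<bar>real_of_int (y j)\<bar> \<le> 4 * real r" if "j < r" for j
    proof -
      have "\<bar>y j\<bar> \<le> (y j)\<^sup>2"
        by (rule abs_le_square_int)
      also have "\<dots> \<le> (\<Sum>j<r. (y j)\<^sup>2)"
        using that by (intro member_le_sum) auto
      finally show ?thesis using y by linarith
    qed
    then have "(\<Sum>j<r. \<bar>X (i, j) * real_of_int (y j)\<bar>) \<le> (\<Sum>j<r. \<bar>X (i, j)\<bar> * (4 * real r))"
      by (intro sum_mono) (auto simp: abs_mult intro!: mult_left_mono)
    then show "\<bar>\<Sum>j<r. X (i, j) * real_of_int (y j)\<bar> \<le> (\<Sum>j<r. \<bar>X (i, j)\<bar> * (4 * real r))"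
      using sum_abs[of "\<lambda>j. X (i, j) * real_of_int (y j)" "{..<r}"] by linarith
  qed (use q in auto)
  have r1: "1 \<le> r" using ij by simp
  have bdd: "bdd_above ((\<lambda>x. lp_norm q (pad_mat n m r X *\<^sub>v x) / lp_norm 2 x) `
      {x \<in> carrier_vec m. x \<noteq> 0\<^sub>v m})"
    by (rule bdd_aboveI2[where M="B / sqrt (real r)"])
       (use two_to_norm_quotient_le[OF q B r1 r bound] in auto)
  let ?e = "unit_vec m j :: real vec"
  have jm: "j < m" using ij r by simp
  have e: "?e \<in> {x \<in> carrier_vec m. x \<noteq> 0\<^sub>v m}" using jm by simp
  have "lp_norm 2 ?e = 1"
    using jm by (simp add: lp_norm_2 unit_vec_def if_distrib[of "\<lambda>x. x\<^sup>2"] sum.delta cong: if_cong)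
  moreover have "\<bar>X (i, j)\<bar> \<le> lp_norm q (pad_mat n m r X *\<^sub>v ?e)"
  proof -
    have "(pad_mat n m r X *\<^sub>v ?e) $ i = X (i, j)"
      using ij r jm by (subst index_pad_mat_mult_vec) (auto simp: unit_vec_def if_distrib sum.delta cong: if_cong)
    then have "\<bar>X (i, j)\<bar> powr q \<le> (\<Sum>i<n. \<bar>(pad_mat n m r X *\<^sub>v ?e) $ i\<bar> powr q)"
      using ij member_le_sum[of i "{..<n}" "\<lambda>i. \<bar>(pad_mat n m r X *\<^sub>v ?e) $ i\<bar> powr q"] by simp
    then have "(\<bar>X (i, j)\<bar> powr q) powr (1 / q) \<le> lp_norm q (pad_mat n m r X *\<^sub>v ?e)"
      unfolding lp_norm_def using q by (auto simp: pad_mat_def intro!: powr_mono2)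
    then show ?thesis
      using q by (simp add: powr_powr)
  qed
  ultimately show ?thesis
    using cSUP_upper[OF e bdd] by (simp add: two_to_norm_def pad_mat_def)
qed

text \<open>Every counted \<open>y\<close> satisfies
  \<open>\<Sum>j<r. \<bar>y j\<bar> \<le> 4 * r\<close>, so the weight
  \<open>16^r * (1/2)^(\<Sum>j<r. \<bar>y j\<bar>)\<close> is at least 1. Summed over the whole box
  the weights factorize, and each coordinate contributes a geometric sum of at most 3.\<close>

lemma card_integer_points_le:
  "card {y \<in> {..<r} \<rightarrow>\<^sub>E {- 4 * int r..4 * int r}. (\<Sum>j<r. (y j)\<^sup>2) \<le> 4 * int r} \<le> 48 ^ r"
  (is "card ?Y \<le> _")
proof -
  let ?B = "{- 4 * int r..4 * int r}"
  have fin: "finite ({..<r} \<rightarrow>\<^sub>E ?B)" by (intro finite_PiE) auto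
  \<comment> \<open>The subtracted term makes the induction close; only the bound 3 is used
    below.\<close>
  have geom: "(\<Sum>z\<in>{- int M..int M}. (1 / 2 :: real) ^ nat \<bar>z\<bar>) \<le> 3 - 2 * (1 / 2) ^ M" for M
  proof (induction M)
    case (Suc M)
    have "{- int (Suc M)..int (Suc M)} = insert (- int (Suc M)) (insert (int (Suc M)) {- int M..int M})"
      by auto
    then have "(\<Sum>z\<in>{- int (Suc M)..int (Suc M)}. (1 / 2 :: real) ^ nat \<bar>z\<bar>)
        = (1 / 2) ^ M + (\<Sum>z\<in>{- int M..int M}. (1 / 2 :: real) ^ nat \<bar>z\<bar>)"
      by (simp add: nat_add_distrib abs_if)
    then show ?case using Suc.IH by simp
  qed simp
  have sub: "?Y \<subseteq> {..<r} \<rightarrow>\<^sub>E ?B" by auto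
  have "real (card ?Y) = (\<Sum>y\<in>?Y. 1)" by simp
  also have "\<dots> \<le> (\<Sum>y\<in>?Y. 16 ^ r * (\<Prod>j<r. (1 / 2) ^ nat \<bar>y j\<bar>))"
  proof (intro sum_mono)
    fix y assume y: "y \<in> ?Y"
    have "int (\<Sum>j<r. nat \<bar>y j\<bar>) = (\<Sum>j<r. \<bar>y j\<bar>)" by simp
    also have "\<dots> \<le> (\<Sum>j<r. (y j)\<^sup>2)"
      by (intro sum_mono abs_le_square_int)
    also have "\<dots> \<le> int (4 * r)" using y by simp
    finally have "(\<Sum>j<r. nat \<bar>y j\<bar>) \<le> 4 * r" by (simp only: of_nat_le_iff)
    then have "(1 / 2 :: real) ^ (4 * r) \<le> (1 / 2) ^ (\<Sum>j<r. nat \<bar>y j\<bar>)"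
      by (intro power_decreasing) auto
    then have "16 ^ r * (1 / 2 :: real) ^ (4 * r) \<le> 16 ^ r * (1 / 2) ^ (\<Sum>j<r. nat \<bar>y j\<bar>)"
      by (intro mult_left_mono) auto
    moreover have "16 ^ r * (1 / 2 :: real) ^ (4 * r) = 1"
    proof -
      have "16 ^ r * (1 / 2 :: real) ^ (4 * r) = (16 * (1 / 2) ^ 4) ^ r"
        by (simp only: power_mult power_mult_distrib)
      also have "16 * (1 / 2 :: real) ^ 4 = 1" by (simp add: power_divide)
      finally show ?thesis by simp
    qed
    ultimately show "1 \<le> (16 :: real) ^ r * (\<Prod>j<r. (1 / 2) ^ nat \<bar>y j\<bar>)"
      by (simp add: power_sum)
  qed
  also have "\<dots> \<le> (\<Sum>y\<in>{..<r} \<rightarrow>\<^sub>E ?B. 16 ^ r * (\<Prod>j<r. (1 / 2) ^ nat \<bar>y j\<bar>))"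
    by (intro sum_mono2 fin sub) (simp add: prod_nonneg)
  also have "\<dots> = 16 ^ r * (\<Prod>j<r. \<Sum>z\<in>?B. (1 / 2) ^ nat \<bar>z\<bar>)"
    by (simp only: sum_distrib_left[symmetric]) (subst prod_sum_PiE, auto)
  also have "\<dots> \<le> 16 ^ r * (\<Prod>j<r. 3)"
  proof (intro mult_left_mono prod_mono conjI)
    have "(\<Sum>z\<in>?B. (1 / 2 :: real) ^ nat \<bar>z\<bar>) \<le> 3 - 2 * (1 / 2) ^ (4 * r)"
      using geom[of "4 * r"] by simp
    also have "\<dots> \<le> 3" by simp
    finally show "(\<Sum>z\<in>?B. (1 / 2 :: real) ^ nat \<bar>z\<bar>) \<le> 3" .
  qed (auto intro!: sum_nonneg)
  also have "\<dots> = real (48 ^ r)"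
    by (simp add: power_mult_distrib[symmetric])
  finally show ?thesis by (simp only: of_nat_le_iff)
qed

section \<open>The norm of a Gaussian matrix\<close>

lemma exp_minus_one_le: "exp x \<le> 1 + x * exp x" for x :: real
  using exp_ge_add_one_self[of "-x"] by (simp add: exp_minus field_simps)

text \<open>For \<open>q > 2\<close> the power \<open>\<bar>t\<bar> powr q\<close> alone has no
  exponential moments under the Gaussian measure. Capping it by \<open>t^2 / 4\<close>, below the
  Gaussian exponent \<open>t^2 / 2\<close>, makes them finite.\<close>

definition tail_fun :: "real \<Rightarrow> real \<Rightarrow> real \<Rightarrow> real" where
  "tail_fun q l t = min (l * \<bar>t\<bar> powr q) (t\<^sup>2 / 4)"

lemma tail_fun_measurable [measurable]: "tail_fun q l \<in> borel_measurable borel"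
  unfolding tail_fun_def by measurable

lemma tail_fun_nonneg: "0 \<le> l \<Longrightarrow> 0 \<le> tail_fun q l t"
  by (simp add: tail_fun_def)

text \<open>This is \<open>x \<le> exp x\<close> at \<open>x = t^2 / (4 * q)\<close>, raised to the
  power \<open>q / 2\<close>.\<close>

lemma abs_powr_le_exp:
  fixes t q :: real
  assumes q: "q > 0"
  shows "\<bar>t\<bar> powr q \<le> (4 * q) powr (q / 2) * exp (t\<^sup>2 / 8)"
proof (cases "t = 0")
  case False
  have "t\<^sup>2 / (4 * q) \<le> exp (t\<^sup>2 / (4 * q))"
    using exp_ge_add_one_self[of "t\<^sup>2 / (4 * q)"] by linarith
  then have "(t\<^sup>2 / (4 * q)) powr (q / 2) \<le> exp (t\<^sup>2 / (4 * q)) powr (q / 2)"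
    using q by (intro powr_mono2) auto
  also have "\<dots> = exp (t\<^sup>2 / 8)"
    using q by (simp add: exp_powr_real)
  finally have "(t\<^sup>2) powr (q / 2) \<le> (4 * q) powr (q / 2) * exp (t\<^sup>2 / 8)"
    using q by (simp add: powr_divide field_simps)
  moreover have "(t\<^sup>2) powr (q / 2) = \<bar>t\<bar> powr q"
  proof -
    have "t\<^sup>2 = \<bar>t\<bar> powr 2" using False by (simp add: powr_numeral)
    then have "(t\<^sup>2) powr (q / 2) = (\<bar>t\<bar> powr 2) powr (q / 2)" by (rule arg_cong)
    then show ?thesis unfolding powr_powr by simp
  qed
  ultimately show ?thesis by simp
qed simp

text \<open>In \<open>exp f \<le> 1 + f * exp f\<close> the factor \<open>f\<close> is bounded by
  its power branch and the exponent by its quadratic branch. This gives an excess over 1 that is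
  linear in \<open>l\<close>, times the integral of \<open>exp (3 * t^2 / 8)\<close>.\<close>

lemma nn_integral_exp_tail_fun:
  assumes q: "q > 0" and l: "l \<ge> 0"
  shows "(\<integral>\<^sup>+t. ennreal (exp (tail_fun q l t)) \<partial>gauss) \<le> ennreal (exp (l * (2 * (4 * q) powr (q / 2))))"
proof -
  define C where "C = (4 * q) powr (q / 2)"
  have C: "C \<ge> 0" by (simp add: C_def)
  have le: "exp (tail_fun q l t) \<le> 1 + l * C * exp (3 * t\<^sup>2 / 8)" for t
  proof -
    have "exp (tail_fun q l t) \<le> 1 + tail_fun q l t * exp (tail_fun q l t)"
      by (rule exp_minus_one_le)
    also have "tail_fun q l t * exp (tail_fun q l t) \<le> (l * \<bar>t\<bar> powr q) * exp (t\<^sup>2 / 4)"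
      using l by (intro mult_mono) (auto simp: tail_fun_def)
    also have "\<dots> \<le> (l * (C * exp (t\<^sup>2 / 8))) * exp (t\<^sup>2 / 4)"
      using l abs_powr_le_exp[OF q, of t] by (intro mult_right_mono mult_left_mono) (auto simp: C_def)
    also have "\<dots> = l * C * exp (3 * t\<^sup>2 / 8)"
      by (simp add: mult.assoc exp_add[symmetric])
    finally show ?thesis by simp
  qed
  \<comment> \<open>The exponents add up to \<open>- t^2 / 8\<close>, that of a normal density with
    standard deviation 2; hence the integral below is 2.\<close>
  have dens: "std_normal_density t * exp (3 * t\<^sup>2 / 8) = 2 * normal_density 0 2 t" for t
  proof -
    have "std_normal_density t * exp (3 * t\<^sup>2 / 8) = 1 / sqrt (2 * pi) * (exp (- t\<^sup>2 / 2) * exp (3 * t\<^sup>2 / 8))"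
      by (simp add: std_normal_density_def)
    also have "exp (- t\<^sup>2 / 2) * exp (3 * t\<^sup>2 / 8) = exp (- (t - 0)\<^sup>2 / (2 * 2\<^sup>2))"
      by (simp add: exp_add[symmetric])
    also have "1 / sqrt (2 * pi) * exp (- (t - 0)\<^sup>2 / (2 * 2\<^sup>2)) = 2 * normal_density 0 2 t"
    proof -
      have "sqrt (2 * pi * 2\<^sup>2) = sqrt (2 * pi) * sqrt (2\<^sup>2)"
        by (rule real_sqrt_mult)
      also have "\<dots> = 2 * sqrt (2 * pi)" by simp
      finally show ?thesis unfolding normal_density_def by simp
    qed
    finally show ?thesis .
  qed
  have "(\<integral>\<^sup>+t. ennreal (exp (3 * t\<^sup>2 / 8)) \<partial>gauss) = (\<integral>\<^sup>+t. ennreal (2 * normal_density 0 2 t) \<partial>lborel)"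
    unfolding gauss_def by (subst nn_integral_density) (auto simp: ennreal_mult'[symmetric] dens)
  also have "\<dots> = 2 * (\<integral>\<^sup>+t. ennreal (normal_density 0 2 t) \<partial>lborel)"
    by (subst nn_integral_cmult[symmetric]) (auto simp: ennreal_mult')
  also have "(\<integral>\<^sup>+t. ennreal (normal_density 0 2 t) \<partial>lborel) = 1"
    by (subst nn_integral_eq_integral) (auto simp: integral_normal_density)
  finally have I: "(\<integral>\<^sup>+t. ennreal (exp (3 * t\<^sup>2 / 8)) \<partial>gauss) = 2" by simp
  have "(\<integral>\<^sup>+t. ennreal (exp (tail_fun q l t)) \<partial>gauss)
      \<le> (\<integral>\<^sup>+t. 1 + ennreal (l * C) * ennreal (exp (3 * t\<^sup>2 / 8)) \<partial>gauss)"
  proof (intro nn_integral_mono)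
    fix t
    have "ennreal (exp (tail_fun q l t)) \<le> ennreal (1 + (l * C) * exp (3 * t\<^sup>2 / 8))"
      using le by (rule ennreal_leI)
    also have "\<dots> = ennreal 1 + ennreal ((l * C) * exp (3 * t\<^sup>2 / 8))"
      using l C by (intro ennreal_plus) auto
    also have "ennreal ((l * C) * exp (3 * t\<^sup>2 / 8)) = ennreal (l * C) * ennreal (exp (3 * t\<^sup>2 / 8))"
      using l C by (intro ennreal_mult) auto
    finally show "ennreal (exp (tail_fun q l t)) \<le> 1 + ennreal (l * C) * ennreal (exp (3 * t\<^sup>2 / 8))"
      by simp
  qed
  also have "\<dots> = 1 + ennreal (l * C) * 2"
    by (subst nn_integral_add) (auto simp: nn_integral_cmult I gauss.emeasure_space_1[simplified])
  also have "\<dots> = ennreal 1 + ennreal (l * C) * ennreal 2"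
    by simp
  also have "\<dots> = ennreal 1 + ennreal (l * C * 2)"
    using l C by (subst ennreal_mult) auto
  also have "\<dots> = ennreal (1 + l * C * 2)"
    using l C by (intro ennreal_plus[symmetric]) auto
  also have "\<dots> = ennreal (1 + l * (2 * C))"
    by (simp add: mult_ac)
  also have "\<dots> \<le> ennreal (exp (l * (2 * C)))"
    by (intro ennreal_leI exp_ge_add_one_self)
  finally show ?thesis by (simp add: C_def)
qed

section \<open>Independence and linear combinations of Gaussian coordinates\<close>

lemma distributed_gauss_PiM_component:
  assumes "i \<in> I"
  shows "distributed (gauss_PiM I) lborel (\<lambda>X. X i) std_normal_density"
proof -
  have "distr (gauss_PiM I) gauss (\<lambda>X. X i) = gauss"
    unfolding gauss_PiM_def using assms by (intro distr_PiM_component prob_space_gauss)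
  then have "distr (gauss_PiM I) lborel (\<lambda>X. X i) = density lborel std_normal_density"
    using distr_cong[of "gauss_PiM I" "gauss_PiM I" gauss lborel "\<lambda>X. X i" "\<lambda>X. X i"]
    by (simp add: gauss_def)
  then show ?thesis
    using assms by (simp add: distributed_def)
qed

lemma indep_vars_gauss_PiM:
  assumes "I \<noteq> {}"
  shows "prob_space.indep_vars (gauss_PiM I) (\<lambda>_. borel) (\<lambda>i X. X i) I"
proof -
  interpret G: prob_space "gauss_PiM I" by (rule prob_space_gauss_PiM)
  have 1: "distr (gauss_PiM I) borel (\<lambda>X. X i) = gauss" if "i \<in> I" for i
  proof -
    have "distr (gauss_PiM I) gauss (\<lambda>X. X i) = gauss"
      unfolding gauss_PiM_def using that by (intro distr_PiM_component prob_space_gauss)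
    then show ?thesis
      using distr_cong[of "gauss_PiM I" "gauss_PiM I" gauss borel "\<lambda>X. X i" "\<lambda>X. X i"] by simp
  qed
  have "distr (gauss_PiM I) (\<Pi>\<^sub>M i\<in>I. borel) (\<lambda>X. \<lambda>i\<in>I. X i) = distr (gauss_PiM I) (gauss_PiM I) (\<lambda>X. X)"
    by (rule distr_cong) (auto simp: extensional_restrict)
  also have "\<dots> = (\<Pi>\<^sub>M i\<in>I. gauss)"
    by (simp add: gauss_PiM_def)
  also have "\<dots> = (\<Pi>\<^sub>M i\<in>I. distr (gauss_PiM I) borel (\<lambda>X. X i))"
    by (intro PiM_cong) (auto simp: 1)
  finally show ?thesis
    using assms by (subst G.indep_vars_iff_distr_eq_PiM') auto
qed

lemma distr_linear_combination_gauss: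
  assumes K: "finite K" "K \<subseteq> I" and v: "(\<Sum>i\<in>K. (v i)\<^sup>2) = 1"
  shows "distr (gauss_PiM I) borel (\<lambda>X. \<Sum>i\<in>K. v i * X i) = gauss"
proof -
  interpret G: prob_space "gauss_PiM I" by (rule prob_space_gauss_PiM)
  \<comment> \<open>Zero coefficients are dropped, since every summand must have positive variance
    to be normally distributed.\<close>
  define J where "J = {i \<in> K. v i \<noteq> 0}"
  have J: "finite J" "J \<subseteq> I" using K by (auto simp: J_def)
  have vJ: "(\<Sum>i\<in>J. (v i)\<^sup>2) = 1"
  proof -
    have "(\<Sum>i\<in>J. (v i)\<^sup>2) = (\<Sum>i\<in>K. (v i)\<^sup>2)"
      unfolding J_def using K by (intro sum.mono_neutral_left) auto
    then show ?thesis using v by simp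
  qed
  then have J0: "J \<noteq> {}" by auto
  have I0: "I \<noteq> {}" using J0 J by auto
  have indep: "G.indep_vars (\<lambda>_. borel) (\<lambda>i X. v i * X i) J"
    by (rule G.indep_vars_compose2[where Y="\<lambda>i t. v i * t",
        OF G.indep_vars_subset[OF indep_vars_gauss_PiM[OF I0] J(2)]]) simp
  have normal: "distributed (gauss_PiM I) lborel (\<lambda>X. v i * X i) (normal_density 0 \<bar>v i\<bar>)" if i: "i \<in> J" for i
  proof -
    have "i \<in> I" "v i \<noteq> 0" using i J by (auto simp: J_def)
    then show ?thesis
      using G.normal_density_affine[where X="\<lambda>X. X i" and \<alpha>="v i" and \<beta>=0 and \<mu>=0 and \<sigma>=1,
          OF distributed_gauss_PiM_component] by simp
  qed
  have pos: "0 < \<bar>v i\<bar>" if "i \<in> J" for i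
    using that by (simp add: J_def)
  have "distributed (gauss_PiM I) lborel (\<lambda>X. \<Sum>i\<in>J. v i * X i)
      (normal_density (\<Sum>i\<in>J. 0) (sqrt (\<Sum>i\<in>J. \<bar>v i\<bar>\<^sup>2)))"
    by (rule G.sum_indep_normal[OF J(1) J0 indep pos normal])
  then have "distributed (gauss_PiM I) lborel (\<lambda>X. \<Sum>i\<in>J. v i * X i) std_normal_density"
    using vJ by simp
  then have "distr (gauss_PiM I) lborel (\<lambda>X. \<Sum>i\<in>J. v i * X i) = gauss"
    unfolding gauss_def by (rule distributed_distr_eq_density)
  moreover have "(\<lambda>X. \<Sum>i\<in>J. v i * X i) = (\<lambda>X. \<Sum>i\<in>K. v i * X i)"
    unfolding J_def using K by (intro ext sum.mono_neutral_left) auto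
  ultimately have "distr (gauss_PiM I) lborel (\<lambda>X. \<Sum>i\<in>K. v i * X i) = gauss"
    by (simp only:)
  then show ?thesis
    using distr_cong[of "gauss_PiM I" "gauss_PiM I" borel lborel "\<lambda>X. \<Sum>i\<in>K. v i * X i" "\<lambda>X. \<Sum>i\<in>K. v i * X i"]
    by simp
qed

text \<open>Different rows use disjoint blocks of entries and are independent, so the integral
  factorizes. The image of the unit vector \<open>v\<close> in each row is standard normal, so every
  factor is bounded by \<open>nn_integral_exp_tail_fun\<close>.\<close>

lemma nn_integral_exp_sum_tail_fun:
  fixes v :: "nat \<Rightarrow> real"
  assumes q: "q > 0" and l: "l \<ge> 0" and v: "(\<Sum>j<r. (v j)\<^sup>2) = 1"
  shows "(\<integral>\<^sup>+X. ennreal (exp (\<Sum>i<n. tail_fun q l (\<Sum>j<r. v j * X (i, j)))) \<partial>gauss_PiM ({..<n} \<times> {..<r}))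
    \<le> ennreal (exp (real n * l * (2 * (4 * q) powr (q / 2))))"
proof (cases "n = 0")
  case True
  then show ?thesis
    using prob_space.emeasure_space_1[OF prob_space_gauss_PiM, of "{} :: (nat \<times> nat) set"] by simp
next
  case False
  let ?I = "{..<n} \<times> {..<r}"
  let ?G = "gauss_PiM ?I"
  interpret G: prob_space ?G by (rule prob_space_gauss_PiM)
  define C where "C = 2 * (4 * q) powr (q / 2)"
  have r: "r > 0" using v by (cases r) auto
  have I0: "?I \<noteq> {}" using False r by auto
  have row: "(\<Sum>p\<in>{i} \<times> {..<r}. f p) = (\<Sum>j<r. f (i, j))" for f :: "nat \<times> nat \<Rightarrow> real" and i
  proof -
    have "{i} \<times> {..<r} = Pair i ` {..<r}" by auto
    then show ?thesis by (simp add: sum.reindex inj_on_def)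
  qed
  define Y where "Y i X = ennreal (exp (tail_fun q l (\<Sum>p\<in>{i} \<times> {..<r}. v (snd p) * X p)))"
    for i :: nat and X :: "nat \<times> nat \<Rightarrow> real"
  have rows: "G.indep_vars (\<lambda>i. Pi\<^sub>M ({i} \<times> {..<r}) (\<lambda>_. borel)) (\<lambda>i X. restrict (\<lambda>p. X p) ({i} \<times> {..<r})) {..<n}"
    by (rule G.indep_vars_restrict[OF indep_vars_gauss_PiM[OF I0]]) (auto simp: disjoint_family_on_def)
  have "Y i \<in> borel_measurable (Pi\<^sub>M ({i} \<times> {..<r}) (\<lambda>_. borel))" for i
  proof -
    have "(\<lambda>X. \<Sum>p\<in>{i} \<times> {..<r}. v (snd p) * X p) \<in> borel_measurable (Pi\<^sub>M ({i} \<times> {..<r}) (\<lambda>_. borel))"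
      by (intro borel_measurable_sum borel_measurable_times borel_measurable_const measurable_component_singleton)
    then show ?thesis
      unfolding Y_def by measurable
  qed
  then have "G.indep_vars (\<lambda>_. borel) (\<lambda>i X. Y i (restrict (\<lambda>p. X p) ({i} \<times> {..<r}))) {..<n}"
    by (intro G.indep_vars_compose2[where Y=Y, OF rows])
  \<comment> \<open>\<open>Y i\<close> reads only row \<open>i\<close>, so the restriction to that
    row disappears.\<close>
  then have indep: "G.indep_vars (\<lambda>_. borel) Y {..<n}"
    by (simp add: Y_def[abs_def])
  have Yint: "(\<integral>\<^sup>+X. Y i X \<partial>?G) \<le> ennreal (exp (l * C))" if i: "i < n" for i
  proof -
    have tail_meas: "(\<lambda>t. ennreal (exp (tail_fun q l t))) \<in> borel_measurable borel"
      by measurable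
    have meas: "(\<lambda>X. \<Sum>p\<in>{i} \<times> {..<r}. v (snd p) * X p) \<in> borel_measurable ?G"
      using i by (intro borel_measurable_sum borel_measurable_times borel_measurable_const
          gauss_PiM_component_measurable) auto
    have "(\<integral>\<^sup>+X. Y i X \<partial>?G)
        = (\<integral>\<^sup>+t. ennreal (exp (tail_fun q l t)) \<partial>distr ?G borel (\<lambda>X. \<Sum>p\<in>{i} \<times> {..<r}. v (snd p) * X p))"
      unfolding Y_def
      by (rule nn_integral_distr[OF meas, where f="\<lambda>t. ennreal (exp (tail_fun q l t))", symmetric])
        (simp only: measurable_distr_eq1 tail_meas)
    also have "distr ?G borel (\<lambda>X. \<Sum>p\<in>{i} \<times> {..<r}. v (snd p) * X p) = gauss"
      using i v by (intro distr_linear_combination_gauss) (auto simp: row)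
    finally show ?thesis
      using nn_integral_exp_tail_fun[OF q l] by (simp add: C_def)
  qed
  have "(\<integral>\<^sup>+X. ennreal (exp (\<Sum>i<n. tail_fun q l (\<Sum>j<r. v j * X (i, j)))) \<partial>?G)
      = (\<integral>\<^sup>+X. (\<Prod>i<n. Y i X) \<partial>?G)"
    by (simp add: Y_def row exp_sum prod_ennreal)
  also have "\<dots> = (\<Prod>i<n. \<integral>\<^sup>+X. Y i X \<partial>?G)"
    by (intro G.indep_vars_nn_integral indep) auto
  also have "\<dots> \<le> (\<Prod>i<n. ennreal (exp (l * C)))"
    using Yint by (intro prod_mono_ennreal) auto
  also have "\<dots> = ennreal (exp (l * C) ^ n)"
    by (simp add: ennreal_power)
  also have "exp (l * C) ^ n = exp (real n * l * C)"
    by (simp only: exp_of_nat_mult mult.assoc)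
  finally show ?thesis by (simp add: C_def)
qed

text \<open>With \<open>l = (K d) powr (2 - q) / 4\<close> the two branches of \<^const>\<open>tail_fun\<close> meet at \<open>K d\<close>: a small sum
  forces all arguments below \<open>K d\<close>, where the function is \<open>l * \<bar>t\<bar> powr q\<close>.\<close>

lemma sum_powr_le_of_sum_tail_fun:
  fixes t :: "nat \<Rightarrow> real"
  assumes q: "q \<ge> 2" and s: "s > 0" and l: "l = s powr (2 - q) / 4"
    and lt: "(\<Sum>i<n. tail_fun q l (t i)) < s\<^sup>2 / 4"
  shows "(\<Sum>i<n. \<bar>t i\<bar> powr q) \<le> s powr q"
proof -
  have l0: "l > 0" using s by (simp add: l)
  have "s powr (2 - q) * s powr q = s powr 2"
    unfolding powr_add[symmetric] by simp
  then have ls: "l * s powr q = s\<^sup>2 / 4"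
    using s by (simp add: l)
  have eq: "tail_fun q l (t i) = l * \<bar>t i\<bar> powr q" if i: "i < n" for i
  proof -
    have "tail_fun q l (t i) \<le> (\<Sum>i<n. tail_fun q l (t i))"
      using i l0 by (intro member_le_sum) (auto intro: tail_fun_nonneg)
    then have small: "tail_fun q l (t i) < s\<^sup>2 / 4" using lt by linarith
    have ts: "\<bar>t i\<bar> < s"
    proof (rule ccontr)
      assume "\<not> \<bar>t i\<bar> < s"
      then have st: "s \<le> \<bar>t i\<bar>" by simp
      have "s powr q \<le> \<bar>t i\<bar> powr q"
        using st q s by (intro powr_mono2) auto
      then have "l * s powr q \<le> l * \<bar>t i\<bar> powr q"
        using l0 by (intro mult_left_mono) auto
      moreover have "s\<^sup>2 \<le> (t i)\<^sup>2"
        using power_mono[OF st, of 2] s by simp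
      ultimately have "s\<^sup>2 / 4 \<le> tail_fun q l (t i)"
        unfolding tail_fun_def ls by simp
      then show False using small by linarith
    qed
    \<comment> \<open>Below \<open>s\<close> the power branch is the smaller one, because
      \<open>l * s powr (q - 2) = 1 / 4\<close>.\<close>
    have "l * \<bar>t i\<bar> powr q \<le> (t i)\<^sup>2 / 4"
    proof (cases "t i = 0")
      case False
      have "\<bar>t i\<bar> powr q = \<bar>t i\<bar> powr (q - 2) * \<bar>t i\<bar> powr 2"
        unfolding powr_add[symmetric] by simp
      also have "\<bar>t i\<bar> powr 2 = (t i)\<^sup>2"
        using False by simp
      also have "\<bar>t i\<bar> powr (q - 2) * (t i)\<^sup>2 \<le> s powr (q - 2) * (t i)\<^sup>2"
        using ts q by (intro mult_right_mono powr_mono2) auto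
      finally have "l * \<bar>t i\<bar> powr q \<le> l * (s powr (q - 2) * (t i)\<^sup>2)"
        using l0 by (intro mult_left_mono) auto
      also have "\<dots> = (t i)\<^sup>2 / 4 * (s powr (2 - q) * s powr (q - 2))"
        unfolding l by (simp only: mult_ac times_divide_eq_right times_divide_eq_left)
      also have "s powr (2 - q) * s powr (q - 2) = 1"
        unfolding powr_add[symmetric] using s by simp
      finally show ?thesis by simp
    qed simp
    then show ?thesis by (simp add: tail_fun_def)
  qed
  have "l * (\<Sum>i<n. \<bar>t i\<bar> powr q) = (\<Sum>i<n. tail_fun q l (t i))"
    unfolding sum_distrib_left by (intro sum.cong) (auto simp: eq)
  then have "l * (\<Sum>i<n. \<bar>t i\<bar> powr q) < l * s powr q"
    using lt by (simp only: ls)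
  then show ?thesis using l0 by simp
qed

text \<open>Markov's inequality for the exponential of the sum.\<close>

lemma measure_sum_tail_fun_ge:
  fixes v :: "nat \<Rightarrow> real" and n r :: nat and q l u :: real
  assumes q: "q > 0" and l: "l \<ge> 0" and v: "(\<Sum>j<r. (v j)\<^sup>2) = 1"
  defines "G \<equiv> gauss_PiM ({..<n} \<times> {..<r})"
  defines "E \<equiv> {X \<in> space G. u \<le> (\<Sum>i<n. tail_fun q l (\<Sum>j<r. v j * X (i, j)))}"
  shows "E \<in> sets G"
    and "measure G E \<le> exp (real n * l * (2 * (4 * q) powr (q / 2)) - u)"
proof -
  let ?f = "\<lambda>X. \<Sum>i<n. tail_fun q l (\<Sum>j<r. v j * X (i, j))"
  define C where "C = 2 * (4 * q) powr (q / 2)"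
  interpret G: prob_space G unfolding G_def by (rule prob_space_gauss_PiM)
  have row: "(\<lambda>X. \<Sum>j<r. v j * X (i, j)) \<in> borel_measurable G" if "i < n" for i
    unfolding G_def using that
    by (intro borel_measurable_sum borel_measurable_times borel_measurable_const
        gauss_PiM_component_measurable) auto
  have f: "?f \<in> borel_measurable G"
    by (intro borel_measurable_sum measurable_compose[OF row tail_fun_measurable]) simp
  show E: "E \<in> sets G"
    unfolding E_def using f by measurable
  have "emeasure G E = (\<integral>\<^sup>+X. indicator E X \<partial>G)"
    using E by simp
  also have "\<dots> \<le> (\<integral>\<^sup>+X. ennreal (exp (- u)) * ennreal (exp (?f X)) \<partial>G)"
  proof (intro nn_integral_mono)
    fix X
    have "1 \<le> exp (- u) * exp (?f X)" if "X \<in> E"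
      using that by (simp add: E_def exp_add[symmetric])
    then have "1 \<le> ennreal (exp (- u) * exp (?f X))" if "X \<in> E"
      using that by simp
    then show "indicator E X \<le> ennreal (exp (- u)) * ennreal (exp (?f X))"
      by (simp add: indicator_def ennreal_mult)
  qed
  also have "\<dots> = ennreal (exp (- u)) * (\<integral>\<^sup>+X. ennreal (exp (?f X)) \<partial>G)"
    by (rule nn_integral_cmult) (rule measurable_compose[OF f], measurable)
  also have "\<dots> \<le> ennreal (exp (- u)) * ennreal (exp (real n * l * C))"
    unfolding C_def G_def by (intro mult_left_mono nn_integral_exp_sum_tail_fun q l v) simp
  also have "\<dots> = ennreal (exp (real n * l * C - u))"
    by (simp add: ennreal_mult[symmetric] exp_add[symmetric])
  finally show "measure G E \<le> exp (real n * l * C - u)"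
    by (simp add: G.emeasure_eq_measure)
qed

text \<open>A union bound over the directions of the nonzero integer points of norm at most
  \<open>2 * sqrt r\<close>. \<open>K\<close> depends on \<open>q\<close> alone, and one event
  serves all widths \<open>m\<close>.\<close>

lemma gauss_two_to_norm_bound:
  fixes q :: real
  assumes q: "q \<ge> 2"
  obtains K where "K > 0" and
    "\<And>n r :: nat. 1 \<le> n \<Longrightarrow> 1 \<le> r \<Longrightarrow>
       \<exists>A \<in> sets (gauss_PiM ({..<n} \<times> {..<r})). measure (gauss_PiM ({..<n} \<times> {..<r})) A \<ge> 9 / 10 \<and>
         (\<forall>X\<in>A. \<forall>m\<ge>r. two_to_norm q (pad_mat n m r X)
            \<le> K * max (real n powr (1 / q)) (sqrt (real r)))"
proof -
  define C where "C = 2 * (4 * q) powr (q / 2)"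
  \<comment> \<open>Then \<open>s^2 / 4 = 10 * d^2 + C * d^2 / 4\<close>. The second summand absorbs
    the moment bound \<open>n * l * C\<close>, and the first leaves the failure probability
    \<open>exp (- 10 * d^2)\<close>.\<close>
  define K where "K = sqrt (40 + C)"
  have C: "C \<ge> 0" by (simp add: C_def)
  have K1: "K \<ge> 1" unfolding K_def using C by simp
  have K2: "K\<^sup>2 = 40 + C" unfolding K_def using C by simp
  have main: "\<exists>A \<in> sets (gauss_PiM ({..<n} \<times> {..<r})). measure (gauss_PiM ({..<n} \<times> {..<r})) A \<ge> 9 / 10 \<and>
         (\<forall>X\<in>A. \<forall>m\<ge>r. two_to_norm q (pad_mat n m r X)
            \<le> 2 * K * max (real n powr (1 / q)) (sqrt (real r)))"
    if n: "1 \<le> n" and r: "1 \<le> r" for n r :: nat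
  proof -
    define d where "d = max (real n powr (1 / q)) (sqrt (real r))"
    define s where "s = K * d"
    define l where "l = s powr (2 - q) / 4"
    let ?G = "gauss_PiM ({..<n} \<times> {..<r})"
    interpret G: prob_space ?G by (rule prob_space_gauss_PiM)
    have d1: "d \<ge> 1"
      unfolding d_def using r by (simp add: le_max_iff_disj)
    have dn: "real n \<le> d powr q"
    proof -
      have "real n = (real n powr (1 / q)) powr q"
        using q n by (simp add: powr_powr)
      also have "\<dots> \<le> d powr q"
        using q by (intro powr_mono2) (auto simp: d_def)
      finally show ?thesis .
    qed
    have dr: "real r \<le> d\<^sup>2"
    proof -
      have "real r = (sqrt (real r))\<^sup>2" by simp
      also have "\<dots> \<le> d\<^sup>2" by (intro power_mono) (auto simp: d_def)
      finally show ?thesis .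
    qed
    have s: "s > 0" using K1 d1 by (simp add: s_def)
    have l0: "l \<ge> 0" by (simp add: l_def)
    \<comment> \<open>As \<open>2 - q \<le> 0\<close> and \<open>s \<ge> d\<close>, the factor
      \<open>s powr (2 - q)\<close> is at most \<open>d powr (2 - q)\<close>, which meets
      \<open>n \<le> d powr q\<close>.\<close>
    have nl: "real n * l \<le> d\<^sup>2 / 4"
    proof -
      have "s powr (2 - q) \<le> d powr (2 - q)"
        unfolding s_def using K1 d1 q by (intro powr_mono2') (auto simp: mult_le_cancel_right1)
      then have "real n * s powr (2 - q) \<le> d powr q * d powr (2 - q)"
        using dn by (intro mult_mono) auto
      also have "\<dots> = d powr 2"
        unfolding powr_add[symmetric] by simp
      also have "\<dots> = d\<^sup>2" using d1 by simp
      finally show ?thesis by (simp add: l_def)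
    qed
    define Y where "Y = {y \<in> {..<r} \<rightarrow>\<^sub>E {- 4 * int r..4 * int r}. (\<Sum>j<r. (y j)\<^sup>2) \<le> 4 * int r}"
    define N where "N y = sqrt (\<Sum>j<r. (real_of_int (y j))\<^sup>2)" for y :: "nat \<Rightarrow> int"
    define E where "E y = {X \<in> space ?G. s\<^sup>2 / 4 \<le> (\<Sum>i<n. tail_fun q l (\<Sum>j<r. real_of_int (y j) / N y * X (i, j)))}" for y
    have finY: "finite Y"
      unfolding Y_def by (rule finite_subset[of _ "{..<r} \<rightarrow>\<^sub>E {- 4 * int r..4 * int r}"]) (auto intro!: finite_PiE)
    have E: "E y \<in> sets ?G \<and> measure ?G (E y) \<le> exp (- 10 * d\<^sup>2)" if y: "N y > 0" for y
    proof -
      have "(\<Sum>j<r. (real_of_int (y j) / N y)\<^sup>2) = (\<Sum>j<r. (real_of_int (y j))\<^sup>2) / (N y)\<^sup>2"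
        by (simp add: power_divide sum_divide_distrib)
      also have "(N y)\<^sup>2 = (\<Sum>j<r. (real_of_int (y j))\<^sup>2)"
        unfolding N_def by (intro real_sqrt_pow2 sum_nonneg) auto
      finally have v: "(\<Sum>j<r. (real_of_int (y j) / N y)\<^sup>2) = 1"
        using y by (simp add: N_def)
      have "q > 0" using q by simp
      note * = measure_sum_tail_fun_ge[OF this l0 v, where n=n and u="s\<^sup>2 / 4", folded C_def E_def]
      have "real n * l * C \<le> d\<^sup>2 / 4 * C"
        using nl C by (rule mult_right_mono)
      then have "real n * l * C - s\<^sup>2 / 4 \<le> - 10 * d\<^sup>2"
        unfolding s_def power_mult_distrib K2 by (simp add: algebra_simps)
      then have "exp (real n * l * C - s\<^sup>2 / 4) \<le> exp (- 10 * d\<^sup>2)"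
        by simp
      then show ?thesis using *(1) order_trans[OF *(2)] by blast
    qed
    \<comment> \<open>The zero vector has no direction; it is treated separately below.\<close>
    define Y' where "Y' = {y \<in> Y. N y > 0}"
    define A where "A = space ?G - (\<Union>y\<in>Y'. E y)"
    have finY': "finite Y'" using finY by (simp add: Y'_def)
    have U: "(\<Union>y\<in>Y'. E y) \<in> sets ?G"
      using E finY' by (intro sets.finite_UN) (auto simp: Y'_def)
    then have A: "A \<in> sets ?G"
      unfolding A_def by (intro sets.Diff sets.top)
    have "measure ?G (\<Union>y\<in>Y'. E y) \<le> (\<Sum>y\<in>Y'. measure ?G (E y))"
      using E finY' by (intro G.finite_measure_subadditive_finite) (auto simp: Y'_def)
    also have "\<dots> \<le> (\<Sum>y\<in>Y'. exp (- 10 * d\<^sup>2))"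
      using E by (intro sum_mono) (auto simp: Y'_def)
    also have "\<dots> = real (card Y') * exp (- 10 * d\<^sup>2)" by simp
    \<comment> \<open>From \<open>48 \<le> 2^6 \<le> exp 6\<close> and
      \<open>r \<le> d^2\<close>.\<close>
    also have "\<dots> \<le> exp (6 * d\<^sup>2) * exp (- 10 * d\<^sup>2)"
    proof (intro mult_right_mono)
      have "card Y' \<le> card Y" unfolding Y'_def by (intro card_mono finY) auto
      also have "\<dots> \<le> 48 ^ r" unfolding Y_def by (rule card_integer_points_le)
      finally have "real (card Y') \<le> real (48 ^ r)" by (simp only: of_nat_le_iff)
      also have "\<dots> \<le> (exp 6) ^ r"
      proof -
        have "(2 :: real) \<le> exp 1" using exp_ge_add_one_self[of 1] by simp
        then have "(2 :: real) ^ 6 \<le> exp 1 ^ 6" by (intro power_mono) auto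
        then have "(48 :: real) \<le> exp 6" by (simp add: exp_of_nat_mult[symmetric])
        then have "(48 :: real) ^ r \<le> exp 6 ^ r" by (intro power_mono) auto
        then show ?thesis by simp
      qed
      also have "\<dots> = exp (real r * 6)" by (rule exp_of_nat_mult[symmetric])
      also have "\<dots> \<le> exp (6 * d\<^sup>2)" using dr by simp
      finally show "real (card Y') \<le> exp (6 * d\<^sup>2)" .
    qed simp
    also have "\<dots> = exp (- 4 * d\<^sup>2)" unfolding exp_add[symmetric] by simp
    also have "\<dots> \<le> exp (- 4 * 1)" using d1 by simp
    also have "\<dots> \<le> 1 / 10"
    proof -
      have "(2 :: real) \<le> exp 1" using exp_ge_add_one_self[of 1] by simp
      then have "(2 :: real) ^ 4 \<le> exp 1 ^ 4" by (intro power_mono) auto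
      then have "(10 :: real) \<le> exp 4" by (simp add: exp_of_nat_mult[symmetric])
      then show ?thesis by (simp add: exp_minus field_simps)
    qed
    finally have "measure ?G A \<ge> 9 / 10"
      unfolding A_def using G.prob_compl[OF U] by simp
    moreover have "two_to_norm q (pad_mat n m r X) \<le> 2 * K * d" if X: "X \<in> A" and m: "m \<ge> r" for X m
    proof -
      \<comment> \<open>Unit directions have image norm at most \<open>s\<close>, so integer points
        of norm at most \<open>2 * sqrt r\<close> have image norm at most
        \<open>2 * sqrt r * s\<close>; this is where the factor 2 in \<open>2 * K\<close>
        arises.\<close>
      have "two_to_norm q (pad_mat n m r X) \<le> (2 * sqrt (real r) * s) / sqrt (real r)"
      proof (rule two_to_norm_pad_mat_le)
        fix y :: "nat \<Rightarrow> int"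
        assume y: "(\<Sum>j<r. (y j)\<^sup>2) \<le> 4 * int r"
        \<comment> \<open>\<open>y\<close> is arbitrary from \<open>r\<close> on, whereas
          \<open>Y\<close> consists of extensional functions.\<close>
        define y' where "y' = restrict y {..<r}"
        have yj: "\<bar>y j\<bar> \<le> 4 * int r" if "j < r" for j
        proof -
          have "\<bar>y j\<bar> \<le> (y j)\<^sup>2" by (rule abs_le_square_int)
          also have "\<dots> \<le> (\<Sum>j<r. (y j)\<^sup>2)" using that by (intro member_le_sum) auto
          finally show ?thesis using y by simp
        qed
        have Y: "y' \<in> Y"
          using y yj by (auto simp: Y_def y'_def abs_le_iff)
             (metis minus_le_iff)
        have Ny': "N y' = N y" by (simp add: N_def y'_def)
        show "(\<Sum>i<n. \<bar>\<Sum>j<r. X (i, j) * real_of_int (y j)\<bar> powr q) \<le> (2 * sqrt (real r) * s) powr q"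
        proof (cases "N y > 0")
          case False
          then have "(\<Sum>j<r. (real_of_int (y j))\<^sup>2) = 0"
            unfolding N_def by (simp add: sum_nonneg order_antisym)
          then have "\<forall>j\<in>{..<r}. (real_of_int (y j))\<^sup>2 = 0"
            by (subst (asm) sum_nonneg_eq_0_iff) auto
          then show ?thesis by simp
        next
          case True
          then have "X \<notin> E y'" "X \<in> space ?G" using X Y Ny' by (auto simp: A_def Y'_def)
          then have "(\<Sum>i<n. tail_fun q l (\<Sum>j<r. real_of_int (y j) / N y * X (i, j))) < s\<^sup>2 / 4"
            by (simp add: E_def Ny') (simp add: y'_def)
          from sum_powr_le_of_sum_tail_fun[OF q s l_def this]
          have le: "(\<Sum>i<n. \<bar>\<Sum>j<r. real_of_int (y j) / N y * X (i, j)\<bar> powr q) \<le> s powr q" .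
          have Nle: "N y \<le> 2 * sqrt (real r)"
          proof -
            have "real_of_int (\<Sum>j<r. (y j)\<^sup>2) \<le> real_of_int (4 * int r)"
              using y by (simp only: of_int_le_iff)
            then have "N y \<le> sqrt (4 * real r)" by (simp add: N_def)
            then show ?thesis by (simp add: real_sqrt_mult)
          qed
          have "(\<Sum>i<n. \<bar>\<Sum>j<r. X (i, j) * real_of_int (y j)\<bar> powr q)
              = (\<Sum>i<n. N y powr q * \<bar>\<Sum>j<r. real_of_int (y j) / N y * X (i, j)\<bar> powr q)"
          proof (intro sum.cong refl)
            fix i
            have "(\<Sum>j<r. X (i, j) * real_of_int (y j)) = N y * (\<Sum>j<r. real_of_int (y j) / N y * X (i, j))"
              unfolding sum_distrib_left using True by (intro sum.cong) auto
            then have "\<bar>\<Sum>j<r. X (i, j) * real_of_int (y j)\<bar> = N y * \<bar>\<Sum>j<r. real_of_int (y j) / N y * X (i, j)\<bar>"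
              using True by (simp only: abs_mult abs_of_pos)
            then show "\<bar>\<Sum>j<r. X (i, j) * real_of_int (y j)\<bar> powr q
                = N y powr q * \<bar>\<Sum>j<r. real_of_int (y j) / N y * X (i, j)\<bar> powr q"
              using True by (simp only: powr_mult)
          qed
          also have "\<dots> \<le> N y powr q * s powr q"
            unfolding sum_distrib_left[symmetric] by (intro mult_left_mono le) simp
          also have "\<dots> = (N y * s) powr q"
            using True s by (subst powr_mult) auto
          also have "\<dots> \<le> (2 * sqrt (real r) * s) powr q"
            using True s q Nle by (intro powr_mono2 mult_right_mono) auto
          finally show ?thesis .
        qed
      qed (use q s r m in auto)
      also have "\<dots> = 2 * K * d" using r by (simp add: s_def)
      finally show ?thesis .
    qed
    ultimately show ?thesis using A unfolding d_def by blast
  qed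
  show ?thesis
    by (rule that[of "2 * K"]) (use K1 main in auto)
qed

section \<open>The rank of a Gaussian matrix\<close>

text \<open>The rank is the size of a maximal independent set of columns. Such a set avoids the zero
  vector, so it consists of columns with index below \<open>r\<close>.\<close>

lemma rank_pad_mat_le:
  assumes "r \<le> m"
  shows "vec_space.rank n (pad_mat n m r X) \<le> r"
proof -
  interpret V: vec_space "TYPE(real)" n .
  let ?A = "pad_mat n m r X"
  have A: "?A \<in> carrier_mat n m" by simp
  obtain S where S: "maximal S (\<lambda>T. T \<subseteq> set (cols ?A) \<and> V.lin_indpt T)"
    using maximal_exists_superset[of "set (cols ?A)" "\<lambda>T. T \<subseteq> set (cols ?A) \<and> V.lin_indpt T" "{}"]
      V.finite_lin_indpt2 by (metis (no_types, lifting) List.finite_set empty_iff empty_subsetI finite.emptyI)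
  then have S1: "S \<subseteq> set (cols ?A)" and li: "V.lin_indpt S" by (auto simp: maximal_def)
  have "S \<subseteq> col ?A ` {..<r}"
  proof
    fix c assume c: "c \<in> S"
    then obtain j where j: "j < m" "c = col ?A j"
      using S1 by (auto simp: cols_def pad_mat_def)
    have "c \<noteq> 0\<^sub>v n"
      using c li V.zero_nin_lin_indpt[of S] S1 cols_dim[of ?A] A by auto
    then have "j < r"
      using j by (intro ccontr[of "j < r"]) (auto simp: pad_mat_def col_def intro!: eq_vecI)
    then show "c \<in> col ?A ` {..<r}" using j by simp
  qed
  then have "card S \<le> card {..<r}"
    by (rule surj_card_le[rotated]) simp
  then show ?thesis
    using V.rank_card_indpt[OF A S] by simp
qed

section \<open>The leading minor of order \<open>r\<close>\<close>

definition top_det :: "nat \<Rightarrow> (nat \<times> nat \<Rightarrow> real) \<Rightarrow> real" where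
  "top_det r X = Determinant.det (mat r r (\<lambda>(i, j). X (i, j)))"

lemma rank_pad_mat:
  assumes r: "r \<le> n" "r \<le> m" and d: "top_det r X \<noteq> 0"
  shows "vec_space.rank n (pad_mat n m r X) = r"
proof (rule antisym)
  show "vec_space.rank n (pad_mat n m r X) \<le> r"
    by (rule rank_pad_mat_le[OF r(2)])
  let ?A = "pad_mat n m r X"
  have pick: "pick {..<r} i = i" if "i < r" for i
  proof -
    have "{a \<in> {..<r}. a < i} = {..<i}" using that by auto
    then show ?thesis using pick_card_in_set[of i "{..<r}"] that by simp
  qed
  have I: "{i. i < n \<and> i < r} = {..<r}" "{i. i < m \<and> i < r} = {..<r}"
    using r by auto
  have "submatrix ?A {..<r} {..<r} = mat r r (\<lambda>(i, j). X (i, j))"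
    using r by (auto simp: submatrix_def pad_mat_def I pick intro!: eq_matI)
  then have "Determinant.det (submatrix ?A {..<r} {..<r}) \<noteq> 0"
    using d by (simp add: top_det_def)
  from vec_space.rank_gt_minor[OF pad_mat_carrier this]
  show "r \<le> vec_space.rank n ?A" by (simp add: I)
qed

text \<open>The Leibniz form makes measurability visible, and also that only entries with indices in
  the product set matter.\<close>

lemma top_det_eq:
  "top_det r X = (\<Sum>p | p permutes {0..<r}. signof p * (\<Prod>i=0..<r. X (i, p i)))"
proof -
  have "top_det r X = (\<Sum>p | p permutes {0..<r}. signof p * (\<Prod>i=0..<r. mat r r (\<lambda>(i, j). X (i, j)) $$ (i, p i)))"
    unfolding top_det_def by (rule det_def') simp
  also have "\<dots> = (\<Sum>p | p permutes {0..<r}. signof p * (\<Prod>i=0..<r. X (i, p i)))"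
    by (intro sum.cong prod.cong arg_cong2[where f="(*)"] refl) (auto simp: permutes_in_image)
  finally show ?thesis .
qed

definition diag_unit :: "nat \<times> nat \<Rightarrow> real" where
  "diag_unit p = (if fst p = snd p then 1 else 0)"

text \<open>The determinant of \<open>X + s I\<close> is the characteristic polynomial of
  \<open>- X\<close> at \<open>s\<close>, which is monic and has finitely many roots.\<close>

lemma finite_top_det_zero:
  "finite {s. top_det r (\<lambda>p. X p + s * diag_unit p) = 0}"
proof -
  define A where "A = mat r r (\<lambda>(i, j). - X (i, j))"
  have A: "A \<in> carrier_mat r r" by (simp add: A_def)
  have "top_det r (\<lambda>p. X p + s * diag_unit p) = poly (char_poly A) s" for s
    unfolding char_poly_def top_det_def
    by (rule poly_det_cong[symmetric, of _ r])
       (auto simp: char_poly_matrix_def A_def diag_unit_def)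
  moreover have "char_poly A \<noteq> 0"
    using degree_monic_char_poly[OF A] by auto
  ultimately show ?thesis
    by (simp add: poly_roots_finite)
qed

lemma top_det_measurable:
  assumes r: "r \<le> n"
  shows "top_det r \<in> borel_measurable (gauss_PiM ({..<n} \<times> {..<r}))"
  unfolding top_det_eq[abs_def]
proof (intro borel_measurable_sum borel_measurable_times borel_measurable_const borel_measurable_prod)
  fix p i assume "p \<in> {p. p permutes {0..<r}}" "i \<in> {0..<r}"
  then have "(i, p i) \<in> {..<n} \<times> {..<r}"
    using r permutes_in_image[of p "{0..<r}" i] by auto
  then show "(\<lambda>X. X (i, p i)) \<in> borel_measurable (gauss_PiM ({..<n} \<times> {..<r}))"
    by (rule gauss_PiM_component_measurable)
qed

text \<open>As a polynomial in \<open>s\<close>, the determinant of \<open>X + s I\<close> is monic, so by Fubini it is almost surely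
  nonzero for some fixed \<open>s\<close>; the laws of \<open>X\<close> and \<open>X + s I\<close> have the same null sets.\<close>

lemma AE_top_det_nonzero:
  assumes r: "r \<le> n"
  shows "AE X in gauss_PiM ({..<n} \<times> {..<r}). top_det r X \<noteq> 0"
proof -
  let ?I = "{..<n} \<times> {..<r}"
  let ?G = "gauss_PiM ?I"
  interpret G: prob_space ?G by (rule prob_space_gauss_PiM)
  interpret P: pair_sigma_finite lborel ?G ..
  have entry: "i < n \<and> p i < r" if "p permutes {0..<r}" "i \<in> {0..<r}" for p i
    using that r permutes_in_image[of p "{0..<r}" i] by auto
  have meas: "(\<lambda>z. top_det r (\<lambda>p. snd z p + fst z * diag_unit p)) \<in> borel_measurable (lborel \<Otimes>\<^sub>M ?G)"
    unfolding top_det_eq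
  proof (intro borel_measurable_sum borel_measurable_times borel_measurable_const borel_measurable_prod borel_measurable_add)
    fix p i assume "p \<in> {p. p permutes {0..<r}}" "i \<in> {0..<r}"
    then have "(i, p i) \<in> ?I" using entry by auto
    then show "(\<lambda>z. snd z (i, p i)) \<in> borel_measurable (lborel \<Otimes>\<^sub>M ?G)"
      by (intro measurable_compose[OF measurable_snd gauss_PiM_component_measurable])
    show "fst \<in> borel_measurable (lborel \<Otimes>\<^sub>M ?G)"
      by measurable
  qed
  have "{z \<in> space (lborel \<Otimes>\<^sub>M ?G). top_det r (\<lambda>p. snd z p + fst z * diag_unit p) \<noteq> 0}
      = (\<lambda>z. top_det r (\<lambda>p. snd z p + fst z * diag_unit p)) -` (- {0}) \<inter> space (lborel \<Otimes>\<^sub>M ?G)"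
    by auto
  then have sets: "{z \<in> space (lborel \<Otimes>\<^sub>M ?G). top_det r (\<lambda>p. snd z p + fst z * diag_unit p) \<noteq> 0}
      \<in> sets (lborel \<Otimes>\<^sub>M ?G)"
    using measurable_sets[OF meas, of "- {0}"] by simp
  have shift_eq: "top_det r (shift ?I (\<lambda>p. s * diag_unit p) X) = top_det r (\<lambda>p. X p + s * diag_unit p)" for s X
    unfolding top_det_eq shift_def using entry by (intro sum.cong prod.cong arg_cong2[where f="(*)"] refl) auto
  have "AE s in lborel. top_det r (\<lambda>p. X p + s * diag_unit p) \<noteq> 0" for X
    using AE_not_in[OF finite_imp_null_set_lborel[OF finite_top_det_zero[of r X]]] by simp
  then have "AE X in ?G. AE s in lborel. top_det r (\<lambda>p. X p + s * diag_unit p) \<noteq> 0"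
    by simp
  then have AE: "AE s in lborel. AE X in ?G. top_det r (\<lambda>p. X p + s * diag_unit p) \<noteq> 0"
    by (subst P.AE_commute[OF sets])
  \<comment> \<open>Lebesgue measure is not zero, so a property that holds almost everywhere holds
    for some \<open>s\<close>.\<close>
  have "ae_filter lborel \<noteq> (bot :: real filter)"
    by (simp add: ae_filter_eq_bot_iff)
  then obtain s where s: "AE X in ?G. top_det r (\<lambda>p. X p + s * diag_unit p) \<noteq> 0"
    using eventually_happens[OF AE] by auto
  have "top_det r \<in> borel_measurable ?G"
    by (rule top_det_measurable[OF r])
  then have "{X \<in> space ?G. top_det r X \<noteq> 0} \<in> sets ?G"
    by measurable
  from AE_shift[OF _ this, of "\<lambda>p. s * diag_unit p"] s show ?thesis
    by (simp add: shift_eq)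
qed

section \<open>Sketching\<close>

definition unit_fun :: "'i \<Rightarrow> 'i \<Rightarrow> real" where
  "unit_fun p = (\<lambda>p'. if p' = p then 1 else 0)"

definition lin_sketch :: "'i set \<Rightarrow> nat \<Rightarrow> (nat \<Rightarrow> 'i \<Rightarrow> real) \<Rightarrow> ('i \<Rightarrow> real) \<Rightarrow> nat \<Rightarrow> real" where
  "lin_sketch I k l X = (\<lambda>b\<in>{..<k}. \<Sum>i\<in>I. X i * l b i)"

lemma lin_sketch_measurable:
  "lin_sketch I k l \<in> gauss_PiM I \<rightarrow>\<^sub>M euclid_borel k"
  unfolding lin_sketch_def
  by (intro measurable_restrict borel_measurable_sum borel_measurable_times
      gauss_PiM_component_measurable borel_measurable_const)

text \<open>The sketch cannot tell a shift by \<open>t\<close> times the \<open>j\<close>-th unit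
  vector from a shift by \<open>t * W j\<close>, its part in the row space. The total variation
  bound with \<open>\<delta> = 1 / 2\<close> costs
  \<open>1 / 4 + 2 * t^2 * \<parallel>W j\<parallel>^2\<close>, and the squared norms add up to at
  most \<open>k\<close>.\<close>

lemma sum_lin_sketch_shift_le:
  fixes l :: "nat \<Rightarrow> 'i \<Rightarrow> real"
  assumes I: "finite I" and B: "B \<in> sets (euclid_borel k)"
  shows "(\<Sum>j\<in>I. measure (gauss_PiM I)
            {X \<in> space (gauss_PiM I). lin_sketch I k l (shift I (\<lambda>i. t * unit_fun j i) X) \<in> B})
         \<le> real (card I) * (1 / 4 + measure (gauss_PiM I) {X \<in> space (gauss_PiM I). lin_sketch I k l X \<in> B})
            + 2 * t\<^sup>2 * real k"
proof -
  let ?G = "gauss_PiM I"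
  define A where "A = {X \<in> space ?G. lin_sketch I k l X \<in> B}"
  have A: "A \<in> sets ?G"
    unfolding A_def using measurable_sets[OF lin_sketch_measurable B, of I l]
    by (simp add: vimage_def Int_def conj_commute)
  obtain W :: "'i \<Rightarrow> 'i \<Rightarrow> real"
    where W: "\<And>j b. j \<in> I \<Longrightarrow> b < k \<Longrightarrow> (\<Sum>i\<in>I. W j i * l b i) = l b j"
      and W2: "(\<Sum>j\<in>I. \<Sum>i\<in>I. (W j i)\<^sup>2) \<le> real k"
    using exists_row_space_projection[OF I, of k l] by blast
  have "measure ?G {X \<in> space ?G. lin_sketch I k l (shift I (\<lambda>i. t * unit_fun j i) X) \<in> B}
      \<le> 1 / 4 + measure ?G A + 2 * t\<^sup>2 * (\<Sum>i\<in>I. (W j i)\<^sup>2)" if j: "j \<in> I" for j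
  proof -
    have "lin_sketch I k l (shift I (\<lambda>i. t * unit_fun j i) X) = lin_sketch I k l (shift I (\<lambda>i. t * W j i) X)" for X
    proof -
      have "(\<Sum>i\<in>I. (X i + t * unit_fun j i) * l b i) = (\<Sum>i\<in>I. (X i + t * W j i) * l b i)" if b: "b < k" for b
      proof -
        have "(\<Sum>i\<in>I. unit_fun j i * l b i) = l b j"
          using I j by (simp add: unit_fun_def mult_delta_left sum.delta)
        then have "t * (\<Sum>i\<in>I. unit_fun j i * l b i) = t * (\<Sum>i\<in>I. W j i * l b i)"
          using W[OF j b] by simp
        then show ?thesis
          by (simp add: distrib_right sum.distrib sum_distrib_left mult.assoc)
      qed
      then show ?thesis
        by (simp add: lin_sketch_def shift_def fun_eq_iff)
    qed
    then have "{X \<in> space ?G. lin_sketch I k l (shift I (\<lambda>i. t * unit_fun j i) X) \<in> B}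
        = {X \<in> space ?G. shift I (\<lambda>i. t * W j i) X \<in> A}"
      by (auto simp: A_def shift_def)
    moreover have "(\<Sum>i\<in>I. (t * W j i)\<^sup>2) / (1 / 2) = 2 * t\<^sup>2 * (\<Sum>i\<in>I. (W j i)\<^sup>2)"
      by (simp add: power_mult_distrib sum_distrib_left[symmetric])
    ultimately show ?thesis
      using gauss_shift_total_variation[OF I A, of "1 / 2" "\<lambda>i. t * W j i"] by simp
  qed
  then have "(\<Sum>j\<in>I. measure ?G {X \<in> space ?G. lin_sketch I k l (shift I (\<lambda>i. t * unit_fun j i) X) \<in> B})
      \<le> (\<Sum>j\<in>I. 1 / 4 + measure ?G A + 2 * t\<^sup>2 * (\<Sum>i\<in>I. (W j i)\<^sup>2))"
    by (rule sum_mono)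
  also have "\<dots> = real (card I) * (1 / 4 + measure ?G A) + 2 * t\<^sup>2 * (\<Sum>j\<in>I. \<Sum>i\<in>I. (W j i)\<^sup>2)"
    by (simp add: sum.distrib sum_distrib_left)
  also have "\<dots> \<le> real (card I) * (1 / 4 + measure ?G A) + 2 * t\<^sup>2 * real k"
    using mult_left_mono[OF W2, of "2 * t\<^sup>2"] by simp
  finally show ?thesis unfolding A_def .
qed

section \<open>Matrix sketches as linear sketches of the vector of entries\<close>

lemma pad_mat_cong:
  "(\<And>i j. i < n \<Longrightarrow> j < r \<Longrightarrow> X (i, j) = Y (i, j)) \<Longrightarrow> pad_mat n m r X = pad_mat n m r Y"
  unfolding pad_mat_def by (intro eq_matI) auto

text \<open>Expansion in matrix units. Both sides are extensional on \<open>{..<k}\<close>, so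
  equality of the coordinates is equality of functions.\<close>

lemma mat_linear_map_pad_mat:
  assumes L: "mat_linear_map n m k L"
  shows "L (pad_mat n m r X)
    = lin_sketch ({..<n} \<times> {..<r}) k (\<lambda>b p. L (pad_mat n m r (unit_fun p)) b) X"
proof -
  let ?M = "pad_mat n m r" and ?I = "{..<n} \<times> {..<r}"
  have add: "L (A + B) b = L A b + L B b"
    if "A \<in> carrier_mat n m" "B \<in> carrier_mat n m" "b < k" for A B b
    using L that by (simp add: mat_linear_map_def)
  have smult: "L (a \<cdot>\<^sub>m A) b = a * L A b" if "A \<in> carrier_mat n m" "b < k" for A a b
    using L that by (simp add: mat_linear_map_def)
  have sum: "L (?M (\<lambda>p'. \<Sum>p\<in>F. X p * unit_fun p p')) b = (\<Sum>p\<in>F. X p * L (?M (unit_fun p)) b)"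
    if "finite F" "b < k" for F b
    using that(1)
  proof (induction F)
    case empty
    have "?M (\<lambda>p'. 0) = 0 \<cdot>\<^sub>m ?M (\<lambda>p'. 0)"
      by (intro eq_matI) (auto simp: pad_mat_def)
    then have "L (?M (\<lambda>p'. 0)) b = 0"
      using smult[of "?M (\<lambda>p'. 0)" b 0] that by simp
    then show ?case by simp
  next
    case (insert p F)
    have "?M (\<lambda>p'. \<Sum>p\<in>insert p F. X p * unit_fun p p')
        = X p \<cdot>\<^sub>m ?M (unit_fun p) + ?M (\<lambda>p'. \<Sum>p\<in>F. X p * unit_fun p p')"
      using insert.hyps by (intro eq_matI) (auto simp: pad_mat_def)
    then show ?case
      using insert that by (simp add: add smult)
  qed
  have "?M X = ?M (\<lambda>p'. \<Sum>p\<in>?I. X p * unit_fun p p')"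
    by (rule pad_mat_cong) (simp add: unit_fun_def mult_delta_right sum.delta)
  then have "L (?M X) b = (\<Sum>p\<in>?I. X p * L (?M (unit_fun p)) b)" if "b < k" for b
    using sum[of ?I b] that by simp
  moreover have "L (?M X) \<in> extensional {..<k}"
    using L by (auto simp: mat_linear_map_def space_PiM PiE_def)
  ultimately show ?thesis
    by (auto simp: lin_sketch_def fun_eq_iff extensional_def)
qed

text \<open>Tonelli: the sections over points of \<open>A\<close> have measure at least
  \<open>a\<close>. An almost everywhere hypothesis suits Gaussian matrices, whose rank is known
  only almost surely.\<close>

lemma pair_measure_ge:
  assumes "prob_space S" "prob_space G" and Q: "Q \<in> sets (S \<Otimes>\<^sub>M G)" and A: "A \<in> sets G"
    and "0 \<le> a" "0 \<le> c"
    and ge: "AE X in G. X \<in> A \<longrightarrow> a \<le> measure S ((\<lambda>L. (L, X)) -` Q)"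
    and mA: "c \<le> measure G A"
  shows "a * c \<le> measure (S \<Otimes>\<^sub>M G) Q"
proof -
  interpret S: prob_space S by fact
  interpret G: prob_space G by fact
  interpret P: pair_prob_space S G ..
  have "ennreal (a * c) \<le> ennreal a * emeasure G A"
    using assms by (simp add: G.emeasure_eq_measure ennreal_mult[symmetric] mult_left_mono ennreal_leI)
  also have "\<dots> = (\<integral>\<^sup>+X. ennreal a * indicator A X \<partial>G)"
    using A by (simp add: nn_integral_cmult_indicator)
  also have "\<dots> \<le> (\<integral>\<^sup>+X. emeasure S ((\<lambda>L. (L, X)) -` Q) \<partial>G)"
    using ge by (intro nn_integral_mono_AE) (auto simp: S.emeasure_eq_measure indicator_def ennreal_leI elim!: eventually_mono)
  also have "\<dots> = emeasure (S \<Otimes>\<^sub>M G) Q"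
    by (rule P.emeasure_pair_measure_alt2[OF Q, symmetric])
  finally show ?thesis by (simp add: P.emeasure_eq_measure)
qed

text \<open>The test whether the output reaches \<open>\<gamma> * T\<close> answers correctly with
  probability at least \<open>5/6 * 9/10 = 3/4\<close>, both on \<open>X\<close> and on every
  single-entry shift. Averaging over the positions bounds how well a sketch of dimension
  \<open>k\<close> can do this.\<close>

lemma sketch_dimension_bound:
  fixes S :: "(real mat \<Rightarrow> nat \<Rightarrow> real) measure" and f :: "(nat \<Rightarrow> real) \<Rightarrow> real"
  assumes \<gamma>: "\<gamma> > 1" and q: "q \<ge> 1" and r: "1 \<le> r" "r \<le> n" "r \<le> m" and T: "T > 0"
    and sk: "sketching_family n m q (rank_class n m r) k \<gamma> S f"
    and A: "A \<in> sets (gauss_PiM ({..<n} \<times> {..<r}))"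
    and mA: "measure (gauss_PiM ({..<n} \<times> {..<r})) A \<ge> 9 / 10"
    and AT: "\<And>X. X \<in> A \<Longrightarrow> two_to_norm q (pad_mat n m r X) \<le> T"
  shows "real n * real r \<le> 8 * ((1 + \<gamma>\<^sup>2) * T)\<^sup>2 * real k"
proof -
  let ?I = "{..<n} \<times> {..<r}"
  let ?G = "gauss_PiM ?I" and ?M = "pad_mat n m r"
  \<comment> \<open>Entries of \<open>X\<close> are at most \<open>T\<close> in modulus on
    \<open>A\<close>, so a shifted entry is at least \<open>t - T = \<gamma>^2 * T\<close>. Then
    \<open>1 / \<gamma>\<close> times the norm is at least \<open>\<gamma> * T\<close>.\<close>
  define t where "t = (1 + \<gamma>\<^sup>2) * T"
  define h where "h X L = f (L (?M X))" for X L
  define sh where "sh p = shift ?I (\<lambda>i. t * unit_fun p i)" for p :: "nat \<times> nat"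
  have S: "prob_space S" and lin: "\<And>L. L \<in> space S \<Longrightarrow> mat_linear_map n m k L"
    and evm: "\<And>A. A \<in> carrier_mat n m \<Longrightarrow> (\<lambda>L. L A) \<in> S \<rightarrow>\<^sub>M euclid_borel k"
    and f: "f \<in> borel_measurable (euclid_borel k)"
    and pr: "\<And>A. A \<in> rank_class n m r \<Longrightarrow> measure S {L \<in> space S.
         f (L A) \<in> {1 / \<gamma> * two_to_norm q A <..< \<gamma> * two_to_norm q A}} \<ge> 5 / 6"
    using sk unfolding sketching_family_def by blast+
  interpret S: prob_space S by (rule S)
  interpret G: prob_space ?G by (rule prob_space_gauss_PiM)
  interpret P: pair_prob_space S ?G ..
  \<comment> \<open>Only evaluations at fixed matrices are known to be measurable in
    \<open>L\<close>. The finitely many coefficients \<open>l L b p\<close> are such evaluations,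
    which makes the sketch jointly measurable in \<open>L\<close> and \<open>X\<close>.\<close>
  define l where "l L b p = L (?M (unit_fun p)) b" for L :: "real mat \<Rightarrow> nat \<Rightarrow> real" and b and p :: "nat \<times> nat"
  have h_eq: "h X L = f (lin_sketch ?I k (l L) X)" if "L \<in> space S" for L X
    unfolding h_def l_def using mat_linear_map_pad_mat[OF lin[OF that], of r X] by simp
  have jm: "(\<lambda>z. f (lin_sketch ?I k (l (fst z)) (snd z))) \<in> borel_measurable (S \<Otimes>\<^sub>M ?G)"
  proof (rule measurable_compose[OF _ f])
    show "(\<lambda>z. lin_sketch ?I k (l (fst z)) (snd z)) \<in> S \<Otimes>\<^sub>M ?G \<rightarrow>\<^sub>M euclid_borel k"
      unfolding lin_sketch_def
    proof (intro measurable_restrict borel_measurable_sum borel_measurable_times)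
      fix b p assume b: "b \<in> {..<k}" and p: "p \<in> ?I"
      show "(\<lambda>z. snd z p) \<in> borel_measurable (S \<Otimes>\<^sub>M ?G)"
        by (rule measurable_compose[OF measurable_snd gauss_PiM_component_measurable[OF p]])
      have "(\<lambda>L. l L b p) \<in> borel_measurable S"
        unfolding l_def
        by (rule measurable_compose[OF evm measurable_component_singleton[OF b]]) simp
      then show "(\<lambda>z. l (fst z) b p) \<in> borel_measurable (S \<Otimes>\<^sub>M ?G)"
        by (rule measurable_compose[OF measurable_fst])
    qed
  qed
  define Q where "Q = {z \<in> space (S \<Otimes>\<^sub>M ?G). h (snd z) (fst z) < \<gamma> * T}"
  define R where "R = {z \<in> space (S \<Otimes>\<^sub>M ?G). \<gamma> * T \<le> h (snd z) (fst z)}"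
  define R' where "R' p = {z \<in> space (S \<Otimes>\<^sub>M ?G). \<gamma> * T \<le> h (sh p (snd z)) (fst z)}" for p
  have hm: "(\<lambda>z. h (snd z) (fst z)) \<in> borel_measurable (S \<Otimes>\<^sub>M ?G)"
    by (subst measurable_cong[OF h_eq]) (auto simp: space_pair_measure intro: jm)
  have Q: "Q \<in> sets (S \<Otimes>\<^sub>M ?G)"
    unfolding Q_def using hm by (rule borel_measurable_less) simp
  have R: "R \<in> sets (S \<Otimes>\<^sub>M ?G)"
    unfolding R_def by (rule borel_measurable_le[OF _ hm]) simp
  have shm: "(\<lambda>z. (fst z, sh p (snd z))) \<in> S \<Otimes>\<^sub>M ?G \<rightarrow>\<^sub>M S \<Otimes>\<^sub>M ?G" for p
    unfolding sh_def
    by (rule measurable_Pair[OF measurable_fst measurable_compose[OF measurable_snd shift_measurable]])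
  have R': "R' p \<in> sets (S \<Otimes>\<^sub>M ?G)" for p
    unfolding R'_def using measurable_compose[OF shm hm, of p]
    by (intro borel_measurable_le) simp_all
  have det: "AE X in ?G. top_det r X \<noteq> 0"
    by (rule AE_top_det_nonzero[OF r(2)])
  have td: "{X \<in> space ?G. top_det r X \<noteq> 0} \<in> sets ?G"
    using measurable_sets[OF top_det_measurable[OF r(2)], of "- {0}"]
    by (simp add: vimage_def Int_def conj_commute)
  \<comment> \<open>Shifting preserves null sets, so the shifted matrices also lie in the rank class
    almost surely.\<close>
  have det': "AE X in ?G. top_det r (sh p X) \<noteq> 0" for p
    unfolding sh_def by (subst AE_shift[OF _ td]) (auto intro: det)
  have rank: "?M X \<in> rank_class n m r" if "top_det r X \<noteq> 0" for X
    using rank_pad_mat[OF r(2,3) that] by (simp add: rank_class_def)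

  have QA: "5 / 6 * (9 / 10) \<le> measure (S \<Otimes>\<^sub>M ?G) Q"
  proof (rule pair_measure_ge[OF S G.prob_space_axioms Q A _ _ _ mA])
    show "AE X in ?G. X \<in> A \<longrightarrow> 5 / 6 \<le> measure S ((\<lambda>L. (L, X)) -` Q)"
      using det
    proof (rule AE_mp, intro AE_I2 impI)
      fix X assume X: "X \<in> space ?G" "top_det r X \<noteq> 0" "X \<in> A"
      have "5 / 6 \<le> measure S {L \<in> space S.
         f (L (?M X)) \<in> {1 / \<gamma> * two_to_norm q (?M X) <..< \<gamma> * two_to_norm q (?M X)}}"
        by (rule pr[OF rank[OF X(2)]])
      also have "\<dots> \<le> measure S ((\<lambda>L. (L, X)) -` Q)"
      proof (rule S.finite_measure_mono)
        have "\<gamma> * two_to_norm q (?M X) \<le> \<gamma> * T"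
          using AT[OF X(3)] \<gamma> by (intro mult_left_mono) auto
        then show "{L \<in> space S. f (L (?M X)) \<in> {1 / \<gamma> * two_to_norm q (?M X) <..< \<gamma> * two_to_norm q (?M X)}}
            \<subseteq> (\<lambda>L. (L, X)) -` Q"
          using X(1) by (auto simp: Q_def h_def space_pair_measure)
        show "(\<lambda>L. (L, X)) -` Q \<in> sets S" by (rule sets_Pair2[OF Q])
      qed
      finally show "5 / 6 \<le> measure S ((\<lambda>L. (L, X)) -` Q)" .
    qed
  qed simp_all
  have R'A: "5 / 6 * (9 / 10) \<le> measure (S \<Otimes>\<^sub>M ?G) (R' p)" if p: "p \<in> ?I" for p
  proof (rule pair_measure_ge[OF S G.prob_space_axioms R' A _ _ _ mA])
    show "AE X in ?G. X \<in> A \<longrightarrow> 5 / 6 \<le> measure S ((\<lambda>L. (L, X)) -` R' p)"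
      using det'[of p]
    proof (rule AE_mp, intro AE_I2 impI)
      fix X assume X: "X \<in> space ?G" "top_det r (sh p X) \<noteq> 0" "X \<in> A"
      obtain i j where ij: "p = (i, j)" "i < n" "j < r" using p by auto
      have "\<bar>X (i, j)\<bar> \<le> T"
        using abs_entry_le_two_to_norm[of q r m i n j X] AT[OF X(3)] q r ij by linarith
      moreover have "sh p X (i, j) = X (i, j) + t"
        using ij by (simp add: sh_def shift_def unit_fun_def)
      ultimately have "\<gamma>\<^sup>2 * T \<le> \<bar>sh p X (i, j)\<bar>"
        by (simp add: t_def algebra_simps abs_if split: if_splits)
      also have "\<dots> \<le> two_to_norm q (?M (sh p X))"
        using q r ij by (intro abs_entry_le_two_to_norm) auto
      finally have "1 / \<gamma> * (\<gamma>\<^sup>2 * T) \<le> 1 / \<gamma> * two_to_norm q (?M (sh p X))"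
        using \<gamma> by (intro mult_left_mono) auto
      then have *: "\<gamma> * T \<le> 1 / \<gamma> * two_to_norm q (?M (sh p X))"
        using \<gamma> by (simp add: power2_eq_square)
      have "5 / 6 \<le> measure S {L \<in> space S. f (L (?M (sh p X)))
          \<in> {1 / \<gamma> * two_to_norm q (?M (sh p X)) <..< \<gamma> * two_to_norm q (?M (sh p X))}}"
        by (rule pr[OF rank[OF X(2)]])
      also have "\<dots> \<le> measure S ((\<lambda>L. (L, X)) -` R' p)"
      proof (rule S.finite_measure_mono)
        show "{L \<in> space S. f (L (?M (sh p X)))
          \<in> {1 / \<gamma> * two_to_norm q (?M (sh p X)) <..< \<gamma> * two_to_norm q (?M (sh p X))}}
            \<subseteq> (\<lambda>L. (L, X)) -` R' p"
          using X(1) * by (auto simp: R'_def h_def space_pair_measure)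
        show "(\<lambda>L. (L, X)) -` R' p \<in> sets S" by (rule sets_Pair2[OF R'])
      qed
      finally show "5 / 6 \<le> measure S ((\<lambda>L. (L, X)) -` R' p)" .
    qed
  qed simp_all

  define N where "N = real n * real r"
  have N: "real (card ?I) = N" by (simp add: N_def)
  have N0: "N \<ge> 0" by (simp add: N_def)
  have ptw: "(\<Sum>p\<in>?I. emeasure ?G (Pair L -` R' p))
      \<le> ennreal (N * (1 / 4) + 2 * t\<^sup>2 * real k) + ennreal N * emeasure ?G (Pair L -` R)"
    if L: "L \<in> space S" for L
  proof -
    \<comment> \<open>For fixed \<open>L\<close> the sections of \<open>R\<close> and
      \<open>R' p\<close> say that the linear sketch of \<open>X\<close>, respectively of the
      shifted \<open>X\<close>, falls into the set \<open>B\<close> of sketch values on which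
      \<open>f\<close> is at least \<open>\<gamma> * T\<close>.\<close>
    define B where "B = f -` {\<gamma> * T..} \<inter> space (euclid_borel k)"
    have B: "B \<in> sets (euclid_borel k)"
      unfolding B_def using f by (rule measurable_sets) simp
    have ls: "lin_sketch ?I k l' X \<in> space (euclid_borel k)" for l' X
      by (simp add: lin_sketch_def space_PiM)
    have 1: "Pair L -` R' p = {X \<in> space ?G. lin_sketch ?I k (l L) (sh p X) \<in> B}" for p
      using L ls by (auto simp: R'_def B_def space_pair_measure h_eq)
    have 2: "Pair L -` R = {X \<in> space ?G. lin_sketch ?I k (l L) X \<in> B}"
      using L ls by (auto simp: R_def B_def space_pair_measure h_eq)
    have "(\<Sum>p\<in>?I. measure ?G (Pair L -` R' p)) \<le> N * (1 / 4 + measure ?G (Pair L -` R)) + 2 * t\<^sup>2 * real k"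
      unfolding 1 2 sh_def N[symmetric] by (rule sum_lin_sketch_shift_le[OF _ B]) simp
    then have "ennreal (\<Sum>p\<in>?I. measure ?G (Pair L -` R' p))
        \<le> ennreal ((N * (1 / 4) + 2 * t\<^sup>2 * real k) + N * measure ?G (Pair L -` R))"
      by (intro ennreal_leI) (simp add: distrib_left)
    also have "\<dots> = ennreal (N * (1 / 4) + 2 * t\<^sup>2 * real k) + ennreal N * emeasure ?G (Pair L -` R)"
      using N0 by (subst ennreal_plus) (auto simp: ennreal_mult G.emeasure_eq_measure)
    finally show ?thesis
      by (simp add: G.emeasure_eq_measure sum_ennreal)
  qed
  have mG: "(\<lambda>L. emeasure ?G (Pair L -` Z)) \<in> borel_measurable S" if "Z \<in> sets (S \<Otimes>\<^sub>M ?G)" for Z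
    by (rule G.measurable_emeasure_Pair[OF that])
  \<comment> \<open>The bound for fixed \<open>L\<close> is integrated over the distribution of
    \<open>L\<close>.\<close>
  have "(\<Sum>p\<in>?I. emeasure (S \<Otimes>\<^sub>M ?G) (R' p)) = (\<Sum>p\<in>?I. \<integral>\<^sup>+L. emeasure ?G (Pair L -` R' p) \<partial>S)"
    by (intro sum.cong refl G.emeasure_pair_measure_alt R')
  also have "\<dots> = (\<integral>\<^sup>+L. (\<Sum>p\<in>?I. emeasure ?G (Pair L -` R' p)) \<partial>S)"
    by (rule nn_integral_sum[symmetric]) (rule mG[OF R'])
  also have "\<dots> \<le> (\<integral>\<^sup>+L. ennreal (N * (1 / 4) + 2 * t\<^sup>2 * real k) + ennreal N * emeasure ?G (Pair L -` R) \<partial>S)"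
    by (rule nn_integral_mono[OF ptw])
  also have "\<dots> = ennreal (N * (1 / 4) + 2 * t\<^sup>2 * real k) + ennreal N * (\<integral>\<^sup>+L. emeasure ?G (Pair L -` R) \<partial>S)"
    using mG[OF R] by (subst nn_integral_add) (auto simp: nn_integral_cmult S.emeasure_space_1)
  also have "(\<integral>\<^sup>+L. emeasure ?G (Pair L -` R) \<partial>S) = emeasure (S \<Otimes>\<^sub>M ?G) R"
    by (rule G.emeasure_pair_measure_alt[OF R, symmetric])
  also have "ennreal (N * (1 / 4) + 2 * t\<^sup>2 * real k) + ennreal N * emeasure (S \<Otimes>\<^sub>M ?G) R
      = ennreal (N * (1 / 4) + 2 * t\<^sup>2 * real k + N * measure (S \<Otimes>\<^sub>M ?G) R)"
    using N0 by (subst ennreal_plus) (auto simp: ennreal_mult P.emeasure_eq_measure)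
  finally have "ennreal (\<Sum>p\<in>?I. measure (S \<Otimes>\<^sub>M ?G) (R' p))
      \<le> ennreal (N * (1 / 4) + 2 * t\<^sup>2 * real k + N * measure (S \<Otimes>\<^sub>M ?G) R)"
    by (simp only: P.emeasure_eq_measure sum_ennreal measure_nonneg)
  moreover have "0 \<le> N * (1 / 4) + 2 * t\<^sup>2 * real k + N * measure (S \<Otimes>\<^sub>M ?G) R"
    using N0 by simp
  ultimately have upper: "(\<Sum>p\<in>?I. measure (S \<Otimes>\<^sub>M ?G) (R' p))
      \<le> N * (1 / 4) + 2 * t\<^sup>2 * real k + N * measure (S \<Otimes>\<^sub>M ?G) R"
    by (simp only: ennreal_le_iff)
  have "R = space (S \<Otimes>\<^sub>M ?G) - Q"
    by (auto simp: R_def Q_def)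
  then have "measure (S \<Otimes>\<^sub>M ?G) R \<le> 1 / 4"
    using QA P.prob_compl[OF Q] by simp
  then have "N * measure (S \<Otimes>\<^sub>M ?G) R \<le> N * (1 / 4)"
    using N0 by (rule mult_left_mono)
  moreover have "(\<Sum>p\<in>?I. 3 / 4) \<le> (\<Sum>p\<in>?I. measure (S \<Otimes>\<^sub>M ?G) (R' p))"
    using R'A by (intro sum_mono) simp
  then have "N * (3 / 4) \<le> (\<Sum>p\<in>?I. measure (S \<Otimes>\<^sub>M ?G) (R' p))"
    by (simp add: N[symmetric])
  \<comment> \<open>Combined: \<open>3/4 * N \<le> 1/4 * N + 2 * t^2 * k + 1/4 * N\<close>.\<close>
  ultimately have "N \<le> 8 * t\<^sup>2 * real k"
    using upper by simp
  then show ?thesis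
    by (simp add: N_def t_def)
qed

theorem theorem4p10:
  fixes q \<gamma> :: real
  assumes "q \<ge> 2" and "\<gamma> > 1"
  shows "\<exists>c>0. \<forall>n m r k :: nat. \<forall>S f.
           1 \<le> r \<longrightarrow> r \<le> n \<longrightarrow> r \<le> m \<longrightarrow>
           sketching_family n m q (rank_class n m r) k \<gamma> S f \<longrightarrow>
           (let d = max (real n powr (1 / q)) (sqrt (real r))
            in real k \<ge> c * (real n * real r / d\<^sup>2))"
proof -
  obtain K where K: "K > 0" and KA: "\<And>n r :: nat. 1 \<le> n \<Longrightarrow> 1 \<le> r \<Longrightarrow>
       \<exists>A \<in> sets (gauss_PiM ({..<n} \<times> {..<r})). measure (gauss_PiM ({..<n} \<times> {..<r})) A \<ge> 9 / 10 \<and>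
         (\<forall>X\<in>A. \<forall>m\<ge>r. two_to_norm q (pad_mat n m r X)
            \<le> K * max (real n powr (1 / q)) (sqrt (real r)))"
    using gauss_two_to_norm_bound[OF assms(1)] by blast
  \<comment> \<open>With \<open>T = K * d\<close> the factor
    \<open>8 * ((1 + \<gamma>^2) * T)^2\<close> equals \<open>D * d^2\<close>, so
    \<open>1 / D\<close> is a constant depending only on \<open>q\<close> and
    \<open>\<gamma>\<close>.\<close>
  define D where "D = 8 * ((1 + \<gamma>\<^sup>2) * K)\<^sup>2"
  have "1 + \<gamma>\<^sup>2 > 0" by (simp add: add_pos_nonneg)
  then have D: "D > 0" using K by (simp add: D_def)
  have "1 / D * (real n * real r / (max (real n powr (1 / q)) (sqrt (real r)))\<^sup>2) \<le> real k"
    if r: "1 \<le> r" "r \<le> n" "r \<le> m" and sk: "sketching_family n m q (rank_class n m r) k \<gamma> S f"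
    for n m r k :: nat and S f
  proof -
    define d where "d = max (real n powr (1 / q)) (sqrt (real r))"
    have d: "d > 0" using r by (simp add: d_def less_max_iff_disj)
    have n: "1 \<le> n" using r by simp
    obtain A where A: "A \<in> sets (gauss_PiM ({..<n} \<times> {..<r}))"
      "measure (gauss_PiM ({..<n} \<times> {..<r})) A \<ge> 9 / 10"
      "\<And>X. X \<in> A \<Longrightarrow> two_to_norm q (pad_mat n m r X) \<le> K * d"
      using KA[OF n r(1)] r(3) unfolding d_def by blast
    have "real n * real r \<le> 8 * ((1 + \<gamma>\<^sup>2) * (K * d))\<^sup>2 * real k"
      using assms K d by (intro sketch_dimension_bound[OF _ _ r _ sk A]) auto
    also have "\<dots> = D * d\<^sup>2 * real k"
      by (simp add: D_def power_mult_distrib)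
    finally have "real n * real r / (D * d\<^sup>2) \<le> real k"
      using D d by (simp add: divide_le_eq mult.commute)
    then show ?thesis
      unfolding d_def[symmetric] by simp
  qed
  then show ?thesis
    using D unfolding Let_def by (intro exI[of _ "1 / D"]) simp
qed

end
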